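(* For every constant $K>0$, with high probability, for every integer $k$ with $0\le k\le \frac{n}{150K\log n}$, \[|\mathcal L_k\cap C_{\tau_{\mathrm{end}}}|\ge \Big(1-\frac1{n^K}\Big)\binom nk.\]
   Context: Let $n\ge 1$ and $\mathcal B=\{0,1\}^n$ with the coordinatewise partial order; $\mathbf 0=(0,\dots,0)$, $\mathbf 1=(1,\dots,1)$, $|x|$ denotes the number of ones of $x$, and $\mathcal L_k=\{x\in\mathcal B:|x|=k\}$ is the $k$th level, so $|\mathcal L_k|=\binom nk$. A random decreasing walk from $\mathbf 1$ is a maximal chain $\mathbf 1=x_n>x_{n-1}>\dots>x_0=\mathbf 0$ with $x_i\in\mathcal L_i$, chosen uniformly among all $n!$ such chains (equivalently, each step turns a uniformly random remaining $1$ into $0$). The DLA process on $\mathcal B$: $C_0=\{\mathbf 0\}$; for $t\ge1$, let $\rho_t$ be a random decreasing walk from $\mathbf 1$, independent of everything before; let $v$ be the last vertex of the longest initial segment of $\rho_t$ that is disjoint from $C_{t-1}$, and set $C_t=C_{t-1}\cup\{v\}$. The process terminates at the first time $\tau_{\mathrm{end}}$ with $\mathbf 1\in C_{\tau_{\mathrm{end}}}$ (for $t>\tau_{\mathrm{end}}$ put $C_t=C_{\tau_{\mathrm{end}}}$). A vertex is occupied at time $t$ if it lies in $C_t$. "With high probability" (w.h.p.) means with probability tending to $1$ as $n\to\infty$; $\log$ is the natural logarithm. *)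

theory Defs
  imports "HOL-Probability.Probability" "HOL-Combinatorics.Multiset_Permutations"
begin

text \<open>Vertices of the hypercube {0,1}^n are encoded as subsets of {0..<n}
  (the set of coordinates equal to 1). The coordinatewise order is inclusion,
  |x| is the cardinality, the bottom vertex is {} and the top vertex is {0..<n}.\<close>

definition cube :: "nat \<Rightarrow> nat set set" where
  "cube n = Pow {0..<n}"

definition level :: "nat \<Rightarrow> nat \<Rightarrow> nat set set" where
  "level n k = {x \<in> cube n. card x = k}"

text \<open>A random decreasing walk from the top: a uniformly random ordering p of the
  coordinates; the walk is x_n = {0..<n}, and at step j the coordinate p!j is turned to 0.
  The list below is [x_n, x_(n-1), ..., x_0].\<close>

definition walk_of :: "nat \<Rightarrow> nat list \<Rightarrow> nat set list" where
  "walk_of n p = map (\<lambda>j. {0..<n} - set (take j p)) [0..<n+1]"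

definition random_walk :: "nat \<Rightarrow> nat set list pmf" where
  "random_walk n = map_pmf (walk_of n) (pmf_of_set (permutations_of_set {0..<n}))"

definition dla_update :: "nat set set \<Rightarrow> nat set list \<Rightarrow> nat set set" where
  "dla_update C w =
     (let s = takeWhile (\<lambda>x. x \<notin> C) w in if s = [] then C else insert (last s) C)"

definition dla_step :: "nat \<Rightarrow> nat set set \<Rightarrow> nat set set pmf" where
  "dla_step n C =
     (if {0..<n} \<in> C then return_pmf C else map_pmf (dla_update C) (random_walk n))"

definition dla_cluster :: "nat \<Rightarrow> nat \<Rightarrow> nat set set pmf" where
  "dla_cluster n t = ((\<lambda>D. bind_pmf D (dla_step n)) ^^ t) (return_pmf {{}})"

text \<open>Every non-terminal step adds a new vertex of the cube, so the process terminates
  after at most 2^n steps; hence C_(tau_end) = C_(2^n).\<close>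

definition dla_final :: "nat \<Rightarrow> nat set set pmf" where
  "dla_final n = dla_cluster n (2 ^ n)"

end

theory Submission
  imports Defs "HOL-Real_Asymp.Real_Asymp"
begin

text \<open>
  Stage \<open>k\<close> of the process ends at time \<open>T k = (n choose (k + 1)) div 10\<close>. Up to that time at most a
  tenth of the vertices of level \<open>k + 1\<close> can have been hit by a walk, and the density on the levels
  above decays geometrically; moreover level \<open>n div 4 + 1\<close> is not even reached. A Chernoff bound shows that, except with
  exponentially small probability, for every \<open>x\<close> in level \<open>k\<close> a walk conditioned to pass
  through \<open>x\<close> is stopped above \<open>x\<close> with probability at most \<open>1/2\<close>. If in addition half of the lower
  neighbours of each \<open>x\<close> are occupied at time \<open>T (k - 1)\<close>, then a set \<open>S\<close> of empty vertices of
  level \<open>k\<close> receives a particle at rate at least \<open>|S| / (4 (n choose k))\<close>, so it stays empty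
  throughout the stage with probability at most \<open>exp (- |S| n / (41 (k + 1)))\<close>.
  A union bound over sets \<open>S\<close> of at least half of the lower neighbours of a vertex of level \<open>k + 1\<close> carries the
  induction on \<open>k\<close>; a union bound over sets of size \<open>(n choose k) / n powr K\<close> gives the theorem.
\<close>

subsection \<open>Counting walks\<close>

definition walk_vertex :: "nat \<Rightarrow> nat list \<Rightarrow> nat \<Rightarrow> nat set" where
  "walk_vertex n p j = {0..<n} - set (take j p)"

text \<open>Given that the prefix exhausts \<open>A\<close>, prefix and suffix are independent
  uniform orderings of \<open>A\<close> and of \<open>V - A\<close>. With \<open>A\<close> the
  complement of a vertex \<open>x\<close>, this separates the part of a walk above \<open>x\<close>
  from the part below it.\<close>

lemma card_permutations_split:
  assumes V: "finite V" and A: "A \<subseteq> V"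
  shows "card {p \<in> permutations_of_set V. set (take (card A) p) = A \<and> P (take (card A) p) \<and> Q (drop (card A) p)}
       = card {q \<in> permutations_of_set A. P q} * card {r \<in> permutations_of_set (V - A). Q r}"
proof -
  let ?L = "{p \<in> permutations_of_set V. set (take (card A) p) = A \<and> P (take (card A) p) \<and> Q (drop (card A) p)}"
  let ?R = "{q \<in> permutations_of_set A. P q} \<times> {r \<in> permutations_of_set (V - A). Q r}"
  have len: "length q = card A" if "q \<in> permutations_of_set A" for q
    using that by (rule length_finite_permutations_of_set)
  have "bij_betw (\<lambda>(q, r). q @ r) ?R ?L"
  proof (rule bij_betwI[where g = "\<lambda>p. (take (card A) p, drop (card A) p)"])
    show "(\<lambda>(q, r). q @ r) \<in> ?R \<rightarrow> ?L"
      using A len by (auto simp: permutations_of_set_def)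
    show "(\<lambda>p. (take (card A) p, drop (card A) p)) \<in> ?L \<rightarrow> ?R"
    proof (rule Pi_I)
      fix p assume p: "p \<in> ?L"
      then have d: "distinct p" and s: "set p = V" and t: "set (take (card A) p) = A"
        by (auto simp: permutations_of_set_def)
      have "set (take (card A) p) \<union> set (drop (card A) p) = V"
        using s by (metis append_take_drop_id set_append)
      moreover have "set (take (card A) p) \<inter> set (drop (card A) p) = {}"
        using d by (simp add: set_take_disj_set_drop_if_distinct)
      ultimately have "set (drop (card A) p) = V - A" using t by auto
      then show "(take (card A) p, drop (card A) p) \<in> ?R"
        using p d t by (auto simp: permutations_of_set_def)
    qed
  qed (auto simp: len)
  then have "card ?R = card ?L" by (rule bij_betw_same_card)
  then show ?thesis by (simp add: card_cartesian_product)
qed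

lemma card_permutations_prefix:
  assumes "finite V" "A \<subseteq> V"
  shows "card {p \<in> permutations_of_set V. set (take (card A) p) = A} = fact (card A) * fact (card V - card A)"
  using card_permutations_split[OF assms, of "\<lambda>_. True" "\<lambda>_. True"] assms finite_subset[OF assms(2,1)]
  by (simp add: card_Diff_subset)

lemma card_permutations_hd:
  assumes V: "finite V" and I: "I \<subseteq> V"
  shows "card {r \<in> permutations_of_set V. hd r \<in> I} = card I * fact (card V - 1)"
proof (cases "V = {}")
  case True
  then show ?thesis using I by simp
next
  case False
  have fI: "finite I" using V I by (rule finite_subset[rotated])
  have "{r \<in> permutations_of_set V. hd r \<in> I} = (\<Union>i\<in>I. {p \<in> permutations_of_set V. set (take (card {i}) p) = {i}})"
  proof -
    have "set (take (Suc 0) r) = {hd r}" if "r \<in> permutations_of_set V" for r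
      using that False by (cases r) (auto simp: permutations_of_set_def)
    then show ?thesis by auto
  qed
  also have "card \<dots> = (\<Sum>i\<in>I. card {p \<in> permutations_of_set V. set (take (card {i}) p) = {i}})"
    by (rule card_UN_disjoint) (use fI V in auto)
  also have "\<dots> = (\<Sum>i\<in>I. fact (card V - 1))"
    using I V by (intro sum.cong refl) (subst card_permutations_prefix, auto)
  finally show ?thesis by simp
qed

section \<open>Vertices visited by a walk\<close>

lemma card_walk_vertex:
  assumes "p \<in> permutations_of_set {0..<n}" "j \<le> n"
  shows "card (walk_vertex n p j) = n - j"
proof -
  have "distinct p" "set p = {0..<n}" "length p = n"
    using assms length_finite_permutations_of_set[of p "{0..<n}"] by (auto simp: permutations_of_set_def)
  then show ?thesis using assms(2) set_take_subset[of j p]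
    by (simp add: walk_vertex_def card_Diff_subset distinct_card)
qed

lemma walk_vertex_subset: "walk_vertex n p j \<subseteq> {0..<n}"
  by (auto simp: walk_vertex_def)

lemma walk_vertex_eq_iff:
  assumes "p \<in> permutations_of_set {0..<n}" "z \<subseteq> {0..<n}"
  shows "walk_vertex n p j = z \<longleftrightarrow> set (take j p) = {0..<n} - z"
  using assms set_take_subset[of j p] by (auto simp: walk_vertex_def permutations_of_set_def)

text \<open>The coordinates outside \<open>z\<close> are removed first, in any order, then those of
  \<open>z\<close>. Divided by \<open>fact n\<close>, the count is the probability 1 / (n choose m)
  that a walk visits \<open>z\<close>.\<close>

lemma card_walks_through:
  assumes "z \<in> level n m"
  shows "card {p \<in> permutations_of_set {0..<n}. walk_vertex n p (n - m) = z} = fact m * fact (n - m)"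
proof -
  have z: "z \<subseteq> {0..<n}" "card z = m" "finite z" using assms finite_subset[of z "{0..<n}"]
    by (auto simp: level_def cube_def)
  have c: "card ({0..<n} - z) = n - m" using z by (simp add: card_Diff_subset)
  have "m \<le> n" using z card_mono[of "{0..<n}" z] by simp
  then show ?thesis
    using card_permutations_prefix[of "{0..<n}" "{0..<n} - z"] c walk_vertex_eq_iff[OF _ z(1)]
    by (simp add: mult.commute cong: conj_cong)
qed

section \<open>The cluster after one walk\<close>

lemma dla_update_walk:
  assumes p: "p \<in> permutations_of_set {0..<n}" and j: "j < n"
    and a: "\<And>i. i \<le> j \<Longrightarrow> walk_vertex n p i \<notin> C" and b: "walk_vertex n p (Suc j) \<in> C"
  shows "dla_update C (walk_of n p) = insert (walk_vertex n p j) C"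
proof -
  let ?w = "map (walk_vertex n p) [0..<n+1]"
  have w: "walk_of n p = ?w" by (simp add: walk_of_def walk_vertex_def)
  have "takeWhile (\<lambda>x. x \<notin> C) ?w = take (Suc j) ?w"
    by (rule takeWhile_eq_take_P_nth) (use a b j in \<open>auto simp: nth_append simp del: upt_Suc\<close>)
  also have "\<dots> = map (walk_vertex n p) [0..<Suc j]"
    using j by (simp add: take_map del: upt_Suc)
  finally show ?thesis by (simp add: dla_update_def w Let_def)
qed

text \<open>The first occupied index \<open>l\<close> exists because the walk ends at the occupied
  \<open>{}\<close>, and is positive because the top is empty; the particle settles at
  \<open>j = l - 1\<close>.\<close>

lemma dla_update_cases:
  assumes p: "p \<in> permutations_of_set {0..<n}" and "{0..<n} \<notin> C" "{} \<in> C"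
  obtains j where "j < n" "\<And>i. i \<le> j \<Longrightarrow> walk_vertex n p i \<notin> C" "walk_vertex n p (Suc j) \<in> C"
    "dla_update C (walk_of n p) = insert (walk_vertex n p j) C"
proof -
  have 0: "walk_vertex n p 0 \<notin> C" using assms by (simp add: walk_vertex_def)
  have "walk_vertex n p n = {}" using card_walk_vertex[OF p, of n] walk_vertex_subset[of n p n]
    by (simp add: finite_subset)
  then have n: "walk_vertex n p n \<in> C" using assms by simp
  define l where "l = (LEAST i. walk_vertex n p i \<in> C)"
  have l: "walk_vertex n p l \<in> C" unfolding l_def using n by (rule LeastI)
  have ln: "l \<le> n" unfolding l_def using n by (rule Least_le)
  have l0: "l \<noteq> 0" using l 0 by metis
  then obtain j where j: "l = Suc j" by (cases l) auto
  have nl: "walk_vertex n p i \<notin> C" if "i \<le> j" for i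
    using that j not_less_Least[of i "\<lambda>i. walk_vertex n p i \<in> C"] by (auto simp: l_def)
  show ?thesis
    by (rule that[of j]) (use ln l j nl dla_update_walk[OF p _ nl, of j] in auto)
qed

text \<open>The last conjunct makes the set of occupied levels an initial segment, so that a
  level can be reached only after all lower ones.\<close>

definition cluster_valid :: "nat \<Rightarrow> nat set set \<Rightarrow> bool" where
  "cluster_valid n C \<longleftrightarrow> {} \<in> C \<and> C \<subseteq> cube n \<and> (\<forall>v\<in>C. \<forall>j\<le>card v. \<exists>w\<in>C. card w = j)"

lemma cluster_valid_initial: "cluster_valid n {{}}"
  by (auto simp: cluster_valid_def cube_def)

lemma cluster_valid_finite: "cluster_valid n C \<Longrightarrow> finite C"
  by (auto simp: cluster_valid_def cube_def intro: finite_subset)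

text \<open>The vertex just below the new particle is occupied and already provides all smaller
  cardinalities.\<close>

lemma cluster_valid_update:
  assumes C: "cluster_valid n C" and "{0..<n} \<notin> C" and p: "p \<in> permutations_of_set {0..<n}"
  shows "cluster_valid n (dla_update C (walk_of n p))"
proof -
  have e: "{} \<in> C" using C by (auto simp: cluster_valid_def)
  obtain j where j: "j < n" "walk_vertex n p (Suc j) \<in> C"
    "dla_update C (walk_of n p) = insert (walk_vertex n p j) C"
    using dla_update_cases[OF p assms(2) e] by metis
  have c: "card (walk_vertex n p j) = n - j" "card (walk_vertex n p (Suc j)) = n - Suc j"
    using j card_walk_vertex[OF p] by simp_all
  have "\<exists>w\<in>insert (walk_vertex n p j) C. card w = i" if i: "i \<le> n - j" for i
  proof (cases "i = n - j")
    case False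
    then have "i \<le> card (walk_vertex n p (Suc j))" using i c by simp
    then show ?thesis using C j(2) by (auto simp: cluster_valid_def)
  qed (use c in auto)
  then show ?thesis
    using C j c walk_vertex_subset[of n p j] unfolding cluster_valid_def by (auto simp: cube_def)
qed

lemma dla_update_superset: "C \<subseteq> dla_update C w"
  by (auto simp: dla_update_def Let_def)

subsection \<open>One-step expectations\<close>

text \<open>The transition operator of the Markov chain acting on observables, clusters containing
  the top being absorbing. It reduces the analysis to inequalities between functions of one cluster,
  without a space of trajectories.\<close>

definition estep :: "nat \<Rightarrow> (nat set set \<Rightarrow> real) \<Rightarrow> nat set set \<Rightarrow> real" where
  "estep n f C = (if {0..<n} \<in> C then f C
     else (\<Sum>p\<in>permutations_of_set {0..<n}. f (dla_update C (walk_of n p))) / fact n)"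

lemma expectation_dla_step: "measure_pmf.expectation (dla_step n C) f = estep n f C"
  by (simp add: dla_step_def estep_def random_walk_def integral_pmf_of_set)

lemma finite_set_pmf_dla_step: "finite (set_pmf (dla_step n C))"
  by (simp add: dla_step_def random_walk_def)

text \<open>Moves the \<open>t\<close> steps from the law to the observable. Finiteness of the
  support is part of the induction because the expectation of a bind is expanded into a finite
  sum.\<close>

lemma expectation_dla_iterate:
  assumes "finite (set_pmf D)"
  shows "finite (set_pmf (((\<lambda>D. bind_pmf D (dla_step n)) ^^ t) D)) \<and>
    measure_pmf.expectation (((\<lambda>D. bind_pmf D (dla_step n)) ^^ t) D) f
      = measure_pmf.expectation D ((estep n ^^ t) f)"
proof (induction t arbitrary: f)
  case (Suc t)
  let ?D = "((\<lambda>D. bind_pmf D (dla_step n)) ^^ t) D"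
  have fin: "finite (set_pmf ?D)" using Suc by blast
  have "measure_pmf.expectation (bind_pmf ?D (dla_step n)) f
      = (\<Sum>C\<in>set_pmf ?D. pmf ?D C *\<^sub>R measure_pmf.expectation (dla_step n C) f)"
    by (rule pmf_expectation_bind) (use fin finite_set_pmf_dla_step in auto)
  also have "\<dots> = measure_pmf.expectation ?D (estep n f)"
    using fin by (subst integral_measure_pmf[of "set_pmf ?D"]) (auto simp: expectation_dla_step)
  also have "\<dots> = measure_pmf.expectation D ((estep n ^^ t) (estep n f))"
    using Suc by blast
  finally show ?case using fin finite_set_pmf_dla_step
    by (simp add: funpow_swap1)
qed (use assms in auto)

section \<open>Probabilities of events at a fixed time\<close>

definition dla_prob :: "nat \<Rightarrow> nat \<Rightarrow> (nat set set \<Rightarrow> bool) \<Rightarrow> real" where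
  "dla_prob n t A = (estep n ^^ t) (\<lambda>C. of_bool (A C)) {{}}"

lemma prob_Collect_not: "measure_pmf.prob M {x. \<not> A x} = 1 - measure_pmf.prob M {x. A x}"
proof -
  have "{x. \<not> A x} = UNIV - {x. A x}" by auto
  then show ?thesis using measure_pmf.prob_compl[of "{x. A x}" M] by simp
qed

lemma prob_dla_cluster: "measure_pmf.prob (dla_cluster n t) {C. A C} = dla_prob n t A"
proof -
  have "measure_pmf.prob (dla_cluster n t) {C. A C}
      = measure_pmf.expectation (dla_cluster n t) (indicat_real {C. A C})"
    by simp
  also have "indicat_real {C. A C} = (\<lambda>C. of_bool (A C))" by (auto simp: indicator_def)
  also have "measure_pmf.expectation (dla_cluster n t) \<dots> = dla_prob n t A"
    unfolding dla_cluster_def dla_prob_def by (subst expectation_dla_iterate[THEN conjunct2]) simp_all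
  finally show ?thesis .
qed

text \<open>Comparison on valid clusters suffices because a step preserves validity; this is how the
  invariant enters later estimates.\<close>

lemma estep_mono:
  assumes "\<And>C. cluster_valid n C \<Longrightarrow> f C \<le> g C" "cluster_valid n C"
  shows "estep n f C \<le> estep n g C"
  using assms cluster_valid_update by (auto simp: estep_def intro!: divide_right_mono sum_mono)

lemma estep_iterate_mono:
  assumes "\<And>C. cluster_valid n C \<Longrightarrow> f C \<le> g C" "cluster_valid n C"
  shows "(estep n ^^ t) f C \<le> (estep n ^^ t) g C"
  using assms(2)
proof (induction t arbitrary: C)
  case (Suc t)
  show ?case using estep_mono[OF Suc.IH Suc.prems] by simp
qed (use assms in auto)

lemma estep_linear:
  "estep n (\<lambda>C. a * f C + b * g C) = (\<lambda>C. a * estep n f C + b * estep n g C)"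
  by (simp add: estep_def fun_eq_iff sum.distrib sum_distrib_left add_divide_distrib)

lemma estep_iterate_linear:
  "(estep n ^^ t) (\<lambda>C. a * f C + b * g C) = (\<lambda>C. a * (estep n ^^ t) f C + b * (estep n ^^ t) g C)"
proof (induction t)
  case (Suc t)
  then show ?case by (simp add: estep_linear)
qed simp

lemma estep_const: "estep n (\<lambda>_. c) = (\<lambda>_. c)"
  by (simp add: estep_def fun_eq_iff)

lemma estep_iterate_const: "(estep n ^^ t) (\<lambda>_. c) = (\<lambda>_. c)"
  by (induction t) (simp_all add: estep_const)

lemma estep_iterate_sum:
  assumes "finite I"
  shows "(estep n ^^ t) (\<lambda>C. \<Sum>i\<in>I. f i C) = (\<lambda>C. \<Sum>i\<in>I. (estep n ^^ t) (f i) C)"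
  using assms
proof (induction I rule: finite_induct)
  case (insert i I)
  then show ?case using estep_iterate_linear[of t n 1 "f i" 1 "\<lambda>C. \<Sum>i\<in>I. f i C"] by simp
qed (simp add: estep_iterate_const)

text \<open>A discrete Gronwall bound: the drift inequality is applied to the last step,
  monotonicity carries it through the earlier ones, and linearity pulls out the factor
  \<open>r\<close>.\<close>

lemma estep_iterate_drift:
  assumes drift: "\<And>C. cluster_valid n C \<Longrightarrow> estep n f C \<le> r * f C" and "r \<ge> 0" and C: "cluster_valid n C"
  shows "(estep n ^^ t) f C \<le> r ^ t * f C"
proof (induction t)
  case (Suc t)
  have "(estep n ^^ Suc t) f C = (estep n ^^ t) (estep n f) C" by (simp add: funpow_swap1)
  also have "\<dots> \<le> (estep n ^^ t) (\<lambda>C. r * f C + 0 * f C) C"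
    by (rule estep_iterate_mono[OF _ C]) (simp add: drift)
  also have "\<dots> = r * (estep n ^^ t) f C" by (subst estep_iterate_linear) simp
  also have "\<dots> \<le> r * (r ^ t * f C)" using Suc assms by (simp add: mult_left_mono)
  finally show ?case by simp
qed simp

text \<open>Clusters only grow, so a decreasing observable has drift factor 1.\<close>

lemma estep_iterate_le_initial:
  assumes anti: "\<And>C C'. cluster_valid n C \<Longrightarrow> cluster_valid n C' \<Longrightarrow> C \<subseteq> C' \<Longrightarrow> f C' \<le> f C"
    and C: "cluster_valid n C"
  shows "(estep n ^^ t) f C \<le> f C"
proof -
  have "estep n f C \<le> 1 * f C" if C: "cluster_valid n C" for C
  proof (cases "{0..<n} \<in> C")
    case False
    have "(\<Sum>p\<in>permutations_of_set {0..<n}. f (dla_update C (walk_of n p)))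
        \<le> (\<Sum>p\<in>permutations_of_set {0..<n}. f C)"
      by (intro sum_mono anti C cluster_valid_update False dla_update_superset)
    then show ?thesis using False by (simp add: estep_def field_simps)
  qed (simp add: estep_def)
  from estep_iterate_drift[OF this _ C] show ?thesis by simp
qed

lemma dla_prob_le_expectation:
  assumes "\<And>C. cluster_valid n C \<Longrightarrow> of_bool (A C) \<le> f C"
  shows "dla_prob n t A \<le> (estep n ^^ t) f {{}}"
  unfolding dla_prob_def by (rule estep_iterate_mono[OF assms cluster_valid_initial])

lemma dla_prob_mono:
  assumes "\<And>C. cluster_valid n C \<Longrightarrow> A C \<Longrightarrow> B C"
  shows "dla_prob n t A \<le> dla_prob n t B"
  unfolding dla_prob_def by (rule estep_iterate_mono[OF _ cluster_valid_initial]) (use assms in auto)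

lemma dla_prob_False: "dla_prob n t (\<lambda>_. False) = 0"
  by (simp add: dla_prob_def estep_iterate_const)

lemma dla_prob_disj: "dla_prob n t (\<lambda>C. A C \<or> B C) \<le> dla_prob n t A + dla_prob n t B"
proof -
  have "dla_prob n t (\<lambda>C. A C \<or> B C)
      \<le> (estep n ^^ t) (\<lambda>C. 1 * of_bool (A C) + 1 * of_bool (B C)) {{}}"
    by (rule dla_prob_le_expectation) simp
  also have "\<dots> = dla_prob n t A + dla_prob n t B"
    by (subst estep_iterate_linear) (simp add: dla_prob_def)
  finally show ?thesis .
qed

lemma dla_prob_bex:
  assumes "finite I"
  shows "dla_prob n t (\<lambda>C. \<exists>i\<in>I. A i C) \<le> (\<Sum>i\<in>I. dla_prob n t (A i))"
  using assms
proof (induction I rule: finite_induct)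
  case (insert i I)
  have "dla_prob n t (\<lambda>C. \<exists>i\<in>insert i I. A i C) = dla_prob n t (\<lambda>C. A i C \<or> (\<exists>i\<in>I. A i C))"
    by simp
  also have "\<dots> \<le> dla_prob n t (A i) + dla_prob n t (\<lambda>C. \<exists>i\<in>I. A i C)" by (rule dla_prob_disj)
  finally show ?case using insert by simp
qed (simp add: dla_prob_False)

text \<open>For decreasing events, such as a level being deficient, a bound at the end of a stage
  stays valid at the final time.\<close>

lemma dla_prob_antimono_time:
  assumes "t \<le> t'" and anti: "\<And>C C'. cluster_valid n C \<Longrightarrow> C \<subseteq> C' \<Longrightarrow> A C' \<Longrightarrow> A C"
  shows "dla_prob n t' A \<le> dla_prob n t A"
proof -
  define f :: "nat set set \<Rightarrow> real" where "f = (\<lambda>C. of_bool (A C))"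
  obtain s where s: "t' = t + s" using assms(1) le_Suc_ex by blast
  have "dla_prob n t' A = (estep n ^^ t) ((estep n ^^ s) f) {{}}"
    by (simp add: dla_prob_def s funpow_add f_def)
  also have "\<dots> \<le> (estep n ^^ t) f {{}}"
    by (intro estep_iterate_mono estep_iterate_le_initial cluster_valid_initial)
       (use anti in \<open>auto simp: f_def\<close>)
  finally show ?thesis by (simp add: dla_prob_def f_def)
qed

subsection \<open>Upper bounds on the growth\<close>

lemma finite_level: "finite (level n m)" and card_level: "card (level n m) = n choose m"
  by (auto simp: level_def cube_def n_subsets)

lemma level_empty: "level n 0 = {{}}"
  by (auto simp: level_def cube_def dest: finite_subset)

text \<open>A walk has exactly one vertex on level \<open>m\<close>, so the events of passing
  through different occupied vertices are disjoint and their probabilities add up to the density of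
  the level.\<close>

lemma card_walks_meeting:
  assumes m: "m \<le> n"
  shows "real (card {p \<in> permutations_of_set {0..<n}. walk_vertex n p (n - m) \<in> C})
    = fact n * real (card (level n m \<inter> C)) / real (n choose m)"
proof -
  let ?P = "permutations_of_set {0..<n}"
  have "{p \<in> ?P. walk_vertex n p (n - m) \<in> C} = (\<Union>z\<in>level n m \<inter> C. {p \<in> ?P. walk_vertex n p (n - m) = z})"
    using m walk_vertex_subset by (fastforce simp: level_def cube_def card_walk_vertex)
  also have "card \<dots> = (\<Sum>z\<in>level n m \<inter> C. card {p \<in> ?P. walk_vertex n p (n - m) = z})"
    by (rule card_UN_disjoint) (auto simp: finite_level)
  also have "\<dots> = card (level n m \<inter> C) * (fact m * fact (n - m))"
    by (simp add: card_walks_through)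
  finally show ?thesis using m by (simp add: binomial_fact)
qed

lemma sum_of_bool_real: "finite P \<Longrightarrow> (\<Sum>p\<in>P. of_bool (Q p)) = real (card {p \<in> P. Q p})"
  by (simp add: of_bool_def sum.If_cases Int_def)

text \<open>A particle can settle on level \<open>Suc m\<close> only if the vertex of the walk on
  level \<open>m\<close> is occupied, which has probability equal to the density of level
  \<open>m\<close>.\<close>

lemma estep_card_level:
  assumes C: "cluster_valid n C" and m: "m < n"
  shows "estep n (\<lambda>C. real (card (level n (Suc m) \<inter> C))) C
    \<le> real (card (level n (Suc m) \<inter> C)) + real (card (level n m \<inter> C)) / real (n choose m)"
proof (cases "{0..<n} \<in> C")
  case False
  let ?P = "permutations_of_set {0..<n}"
  let ?X = "\<lambda>C. real (card (level n (Suc m) \<inter> C))"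
  have fC: "finite C" by (rule cluster_valid_finite[OF C])
  have "?X (dla_update C (walk_of n p)) \<le> ?X C + of_bool (walk_vertex n p (n - m) \<in> C)" if p: "p \<in> ?P" for p
  proof -
    obtain j where j: "j < n" "walk_vertex n p (Suc j) \<in> C"
      "dla_update C (walk_of n p) = insert (walk_vertex n p j) C"
      using dla_update_cases[OF p False] C unfolding cluster_valid_def by metis
    show ?thesis
    proof (cases "walk_vertex n p j \<in> level n (Suc m)")
      case True
      then have "n - j = Suc m" using j(1) card_walk_vertex[OF p, of j] by (simp add: level_def)
      then have "Suc j = n - m" by simp
      then have "walk_vertex n p (n - m) \<in> C" using j by metis
      moreover have "card (level n (Suc m) \<inter> insert (walk_vertex n p j) C) \<le> Suc (card (level n (Suc m) \<inter> C))"
        using True fC by (simp add: card_insert_if)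
      ultimately show ?thesis using j by simp
    qed (use j in simp)
  qed
  then have "(\<Sum>p\<in>?P. ?X (dla_update C (walk_of n p))) \<le> (\<Sum>p\<in>?P. ?X C + of_bool (walk_vertex n p (n - m) \<in> C))"
    by (rule sum_mono)
  also have "\<dots> = fact n * ?X C + fact n * real (card (level n m \<inter> C)) / real (n choose m)"
    using m by (simp add: sum.distrib card_walks_meeting sum_of_bool_real del: sum_of_bool_eq)
  finally show ?thesis using False by (simp add: estep_def field_simps)
qed (simp add: estep_def)

text \<open>Level \<open>Suc m\<close> starts empty and gains at most
  \<open>b / (n choose m)\<close> in expectation per step. Feeding the bound for one level into the
  next gives the decay above level \<open>k + 1\<close>.\<close>

lemma expectation_card_level_rec:
  assumes m: "m < n" and b: "\<And>s. s < T \<Longrightarrow> (estep n ^^ s) (\<lambda>C. real (card (level n m \<inter> C))) {{}} \<le> b" "b \<ge> 0"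
    and t: "t \<le> T"
  shows "(estep n ^^ t) (\<lambda>C. real (card (level n (Suc m) \<inter> C))) {{}} \<le> real t * b / real (n choose m)"
  using t
proof (induction t)
  case 0
  have "level n (Suc m) \<inter> {{}} = {}" by (auto simp: level_def)
  then show ?case by simp
next
  case (Suc t)
  let ?X = "\<lambda>m C. real (card (level n m \<inter> C))"
  have "(estep n ^^ Suc t) (?X (Suc m)) {{}} = (estep n ^^ t) (estep n (?X (Suc m))) {{}}"
    by (simp add: funpow_swap1)
  also have "\<dots> \<le> (estep n ^^ t) (\<lambda>C. 1 * ?X (Suc m) C + (1 / real (n choose m)) * ?X m C) {{}}"
    by (rule estep_iterate_mono[OF _ cluster_valid_initial]) (use estep_card_level[OF _ m] in simp)
  also have "\<dots> = (estep n ^^ t) (?X (Suc m)) {{}} + (1 / real (n choose m)) * (estep n ^^ t) (?X m) {{}}"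
    by (subst estep_iterate_linear) simp
  also have "\<dots> \<le> real t * b / real (n choose m) + (1 / real (n choose m)) * b"
    by (intro add_mono mult_left_mono b(1)) (use Suc in auto)
  finally show ?case by (simp add: field_simps add_divide_distrib)
qed

lemma expectation_card_level_le_time:
  assumes m: "m < n" and t: "t \<le> T"
  shows "(estep n ^^ t) (\<lambda>C. real (card (level n (Suc m) \<inter> C))) {{}} \<le> real T"
proof -
  have "(estep n ^^ s) (\<lambda>C. real (card (level n m \<inter> C))) {{}} \<le> real (n choose m)" for s
  proof -
    have "(estep n ^^ s) (\<lambda>C. real (card (level n m \<inter> C))) {{}} \<le> (estep n ^^ s) (\<lambda>_. real (n choose m)) {{}}"
      by (rule estep_iterate_mono[OF _ cluster_valid_initial])
         (metis card_level card_mono finite_level inf_le1 of_nat_mono)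
    then show ?thesis by (simp add: estep_iterate_const)
  qed
  from expectation_card_level_rec[OF m this _ t]
  have "(estep n ^^ t) (\<lambda>C. real (card (level n (Suc m) \<inter> C))) {{}} \<le> real t * real (n choose m) / real (n choose m)"
    by simp
  also have "\<dots> \<le> real T" using m t by simp
  finally show ?thesis .
qed

text \<open>One step of a Chernoff argument. At most one vertex is added; \<open>z\<close> can be
  added only if the walk visits it, with probability 1 / (n choose card z), and this multiplies the
  exponential by \<open>exp (u z)\<close>. The resulting factor does not depend on \<open>C\<close>,
  so it can be iterated.\<close>

lemma estep_exp_weight:
  assumes C: "cluster_valid n C" and Z: "Z \<subseteq> cube n" and u: "\<And>z. z \<in> Z \<Longrightarrow> u z \<ge> 0"
  shows "estep n (\<lambda>C. exp (\<Sum>z\<in>Z \<inter> C. u z)) C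
    \<le> (1 + (\<Sum>z\<in>Z. (exp (u z) - 1) / real (n choose card z))) * exp (\<Sum>z\<in>Z \<inter> C. u z)"
proof -
  let ?P = "permutations_of_set {0..<n}"
  let ?f = "\<lambda>C. exp (\<Sum>z\<in>Z \<inter> C. u z)"
  let ?v = "\<lambda>z. exp (u z) - 1"
  have fC: "finite C" by (rule cluster_valid_finite[OF C])
  have fZ: "finite Z" using Z by (auto simp: cube_def intro: finite_subset)
  have v: "z \<in> Z \<Longrightarrow> ?v z \<ge> 0" for z using u by simp
  show ?thesis
  proof (cases "{0..<n} \<in> C")
    case True
    have "(\<Sum>z\<in>Z. ?v z / real (n choose card z)) \<ge> 0" using v by (intro sum_nonneg) simp
    then have "1 * ?f C \<le> (1 + (\<Sum>z\<in>Z. ?v z / real (n choose card z))) * ?f C" by (intro mult_right_mono) auto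
    then show ?thesis using True by (simp add: estep_def)
  next
    case False
    have "?f (dla_update C (walk_of n p))
        \<le> ?f C * (1 + (\<Sum>z\<in>Z. of_bool (walk_vertex n p (n - card z) = z) * ?v z))" if p: "p \<in> ?P" for p
    proof -
      obtain j where j: "j < n" "dla_update C (walk_of n p) = insert (walk_vertex n p j) C"
        using dla_update_cases[OF p False] C unfolding cluster_valid_def by metis
      let ?z = "walk_vertex n p j"
      let ?s = "\<Sum>z\<in>Z. of_bool (walk_vertex n p (n - card z) = z) * ?v z"
      have s0: "?s \<ge> 0" using v by (intro sum_nonneg) simp
      show ?thesis
      proof (cases "?z \<in> Z \<and> ?z \<notin> C")
        case True
        have "(\<Sum>z\<in>Z \<inter> insert ?z C. u z) = u ?z + (\<Sum>z\<in>Z \<inter> C. u z)"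
          using True fC by simp
        then have "?f (insert ?z C) = ?f C * (1 + ?v ?z)" by (simp add: exp_add mult.commute)
        moreover have "?v ?z \<le> ?s"
        proof -
          have "n - card ?z = j" using j card_walk_vertex[OF p, of j] by simp
          then have "?v ?z = of_bool (walk_vertex n p (n - card ?z) = ?z) * ?v ?z" by simp
          also have "\<dots> \<le> ?s" using True fZ v
            by (intro member_le_sum) auto
          finally show ?thesis .
        qed
        ultimately show ?thesis using j by (simp add: mult_left_mono)
      next
        case False
        then have "Z \<inter> insert ?z C = Z \<inter> C" by auto
        then show ?thesis using j s0 by simp
      qed
    qed
    then have "(\<Sum>p\<in>?P. ?f (dla_update C (walk_of n p)))
        \<le> (\<Sum>p\<in>?P. ?f C * (1 + (\<Sum>z\<in>Z. of_bool (walk_vertex n p (n - card z) = z) * ?v z)))"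
      by (rule sum_mono)
    also have "\<dots> = ?f C * (fact n + (\<Sum>z\<in>Z. \<Sum>p\<in>?P. of_bool (walk_vertex n p (n - card z) = z) * ?v z))"
      by (subst sum.swap) (simp add: sum.distrib flip: sum_distrib_left)
    also have "(\<Sum>z\<in>Z. \<Sum>p\<in>?P. of_bool (walk_vertex n p (n - card z) = z) * ?v z)
        = (\<Sum>z\<in>Z. fact n * (?v z / real (n choose card z)))"
    proof (rule sum.cong[OF refl])
      fix z assume z: "z \<in> Z"
      then have zl: "z \<in> level n (card z)" and zn: "card z \<le> n"
        using Z card_mono[of "{0..<n}" z] by (auto simp: level_def cube_def)
      have "(\<Sum>p\<in>?P. of_bool (walk_vertex n p (n - card z) = z) * ?v z)
          = real (card {p \<in> ?P. walk_vertex n p (n - card z) = z}) * ?v z"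
        by (simp add: sum_of_bool_real del: sum_of_bool_eq flip: sum_distrib_right)
      also have "\<dots> = fact n * (?v z / real (n choose card z))"
        unfolding card_walks_through[OF zl] using zn by (simp add: binomial_fact)
      finally show "(\<Sum>p\<in>?P. of_bool (walk_vertex n p (n - card z) = z) * ?v z)
          = fact n * (?v z / real (n choose card z))" .
    qed
    also have "?f C * (fact n + (\<Sum>z\<in>Z. fact n * (?v z / real (n choose card z))))
        = fact n * ((1 + (\<Sum>z\<in>Z. ?v z / real (n choose card z))) * ?f C)"
      by (simp add: algebra_simps sum_distrib_left)
    finally show ?thesis using False by (simp add: estep_def field_simps)
  qed
qed

text \<open>Markov's inequality for the exponential weight. Since \<open>{}\<close> is not in
  \<open>Z\<close>, the weight starts at \<open>exp 0 = 1\<close>.\<close>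

lemma dla_prob_weight_tail:
  assumes Z: "Z \<subseteq> cube n" "{} \<notin> Z" and u: "\<And>z. z \<in> Z \<Longrightarrow> u z \<ge> 0"
  shows "dla_prob n t (\<lambda>C. a \<le> (\<Sum>z\<in>Z \<inter> C. u z))
    \<le> exp (real t * (\<Sum>z\<in>Z. (exp (u z) - 1) / real (n choose card z)) - a)"
proof -
  let ?f = "\<lambda>C. exp (\<Sum>z\<in>Z \<inter> C. u z)"
  let ?s = "\<Sum>z\<in>Z. (exp (u z) - 1) / real (n choose card z)"
  have s0: "?s \<ge> 0" using u by (intro sum_nonneg) simp
  have "dla_prob n t (\<lambda>C. a \<le> (\<Sum>z\<in>Z \<inter> C. u z)) \<le> (estep n ^^ t) (\<lambda>C. exp (-a) * ?f C + 0 * ?f C) {{}}"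
    by (rule dla_prob_le_expectation) (auto simp flip: exp_add)
  also have "\<dots> = exp (-a) * (estep n ^^ t) ?f {{}}"
    by (subst estep_iterate_linear) simp
  also have "(estep n ^^ t) ?f {{}} \<le> (1 + ?s) ^ t * ?f {{}}"
    by (rule estep_iterate_drift[OF estep_exp_weight]) (use Z u s0 cluster_valid_initial in auto)
  also have "?f {{}} = 1" using Z by simp
  also have "(1 + ?s) ^ t \<le> exp ?s ^ t" using s0 by (intro power_mono exp_ge_add_one_self) auto
  also have "\<dots> = exp (real t * ?s)" by (simp add: exp_of_nat_mult)
  finally show ?thesis by (simp add: mult_left_mono mult_exp_exp algebra_simps)
qed

subsection \<open>Filling a level\<close>

text \<open>The expected number of occupied vertices that a walk conditioned to pass through \<open>x\<close>
  meets above \<open>x\<close>.\<close>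

definition blocking :: "nat \<Rightarrow> nat set \<Rightarrow> nat set set \<Rightarrow> real" where
  "blocking n x C = (\<Sum>z\<in>{z \<in> C. x \<subset> z}. 1 / real ((n - card x) choose (card z - card x)))"

definition unblocked :: "nat \<Rightarrow> nat \<Rightarrow> nat set set \<Rightarrow> bool" where
  "unblocked n k C \<longleftrightarrow> (\<forall>x\<in>level n k. blocking n x C \<le> 1/2)"

definition supported :: "nat \<Rightarrow> nat \<Rightarrow> nat set set \<Rightarrow> bool" where
  "supported n k C \<longleftrightarrow> (\<forall>x\<in>level n k. k \<le> 2 * card {i \<in> x. x - {i} \<in> C})"

text \<open>Each of these walks deposits its particle at \<open>x\<close>, by
  \<open>dla_update_walk\<close>.\<close>

definition hitting_walks :: "nat \<Rightarrow> nat set \<Rightarrow> nat set set \<Rightarrow> nat list set" where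
  "hitting_walks n x C = {p \<in> permutations_of_set {0..<n}. walk_vertex n p (n - card x) = x \<and>
     (\<forall>i\<le>n - card x. walk_vertex n p i \<notin> C) \<and> walk_vertex n p (Suc (n - card x)) \<in> C}"

text \<open>Union bound: an ordering that meets an occupied \<open>z\<close> has the complement of
  \<open>z\<close> as a prefix, which happens for a fraction 1 / ((n - k) choose (card z - k)) of
  the orderings of the complement of \<open>x\<close>. As \<open>x\<close> is empty, every such
  \<open>z\<close> lies strictly above \<open>x\<close>, so the fractions sum to
  \<open>blocking n x C\<close>.\<close>

lemma card_unblocked_prefixes:
  assumes C: "finite C" "C \<subseteq> cube n" and x: "x \<in> level n k" "x \<notin> C"
  shows "real (card {q \<in> permutations_of_set ({0..<n} - x). \<forall>i\<le>n - k. {0..<n} - set (take i q) \<notin> C})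
    \<ge> fact (n - k) * (1 - blocking n x C)"
proof -
  let ?U = "{0..<n}"
  let ?P = "permutations_of_set (?U - x)"
  let ?Z = "{z \<in> C. x \<subset> z}"
  let ?G = "{q \<in> ?P. \<forall>i\<le>n - k. ?U - set (take i q) \<notin> C}"
  let ?B = "\<lambda>z. {q \<in> ?P. set (take (card (?U - z)) q) = ?U - z}"
  have xU: "x \<subseteq> ?U" and cx: "card x = k" and fx: "finite x"
    using x finite_subset[of x ?U] by (auto simp: level_def cube_def)
  have cUx: "card (?U - x) = n - k" using xU cx fx by (simp add: card_Diff_subset)
  have sub: "?P - ?G \<subseteq> (\<Union>z\<in>?Z. ?B z)"
  proof
    fix q assume "q \<in> ?P - ?G"
    then obtain i where q: "q \<in> ?P" and i: "i \<le> n - k" "?U - set (take i q) \<in> C" by auto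
    have dq: "distinct q" "set q = ?U - x" "length q = n - k"
      using q cUx length_finite_permutations_of_set[OF q] by (auto simp: permutations_of_set_def)
    let ?z = "?U - set (take i q)"
    have tq: "set (take i q) \<subseteq> ?U - x" using dq set_take_subset[of i q] by auto
    have "x \<subseteq> ?z" using tq xU by auto
    then have "x \<subset> ?z" using i x by auto
    moreover have eq: "?U - ?z = set (take i q)" using tq by auto
    moreover have "card (set (take i q)) = i" using dq i by (simp add: distinct_card)
    ultimately show "q \<in> (\<Union>z\<in>?Z. ?B z)" using i q by (intro UN_I[of ?z]) auto
  qed
  have "card (?P - ?G) \<le> card (\<Union>z\<in>?Z. ?B z)"
    using sub C by (intro card_mono) auto
  also have "\<dots> \<le> (\<Sum>z\<in>?Z. card (?B z))"
    using C by (intro card_UN_le) auto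
  finally have "real (card (?P - ?G)) \<le> (\<Sum>z\<in>?Z. real (card (?B z)))"
    by (simp flip: of_nat_sum)
  also have "\<dots> = (\<Sum>z\<in>?Z. fact (n - k) * (1 / real ((n - k) choose (card z - k))))"
  proof (rule sum.cong[OF refl])
    fix z assume z: "z \<in> ?Z"
    then have zU: "z \<subseteq> ?U" and fz: "finite z" and xz: "x \<subset> z" using C finite_subset[of z ?U] by (auto simp: cube_def)
    have cz: "k \<le> card z" "card z \<le> n" using card_mono[of z x] card_mono[of ?U z] xz cx fz zU by auto
    have cUz: "card (?U - z) = n - card z" using zU fz by (simp add: card_Diff_subset)
    have "card (?B z) = fact (n - card z) * fact (card z - k)"
      using card_permutations_prefix[of "?U - x" "?U - z"] xz cUz cUx cz by auto
    then show "real (card (?B z)) = fact (n - k) * (1 / real ((n - k) choose (card z - k)))"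
      using cz by (simp add: binomial_fact)
  qed
  also have "\<dots> = fact (n - k) * blocking n x C"
    by (simp add: blocking_def cx sum_distrib_left)
  finally have "real (card (?P - ?G)) \<le> fact (n - k) * blocking n x C" .
  moreover have "card (?P - ?G) = card ?P - card ?G" by (intro card_Diff_subset) auto
  moreover have "card ?G \<le> card ?P" by (intro card_mono) auto
  ultimately show ?thesis using cUx by (simp add: algebra_simps of_nat_diff)
qed

text \<open>A walk visits \<open>x\<close> with probability 1 / (n choose k). Given this, it is
  unobstructed above \<open>x\<close> with probability at least 1/2 and, independently, its next
  step leads to an occupied lower neighbour with probability at least 1/2.\<close>

lemma card_hitting_walks:
  assumes C: "finite C" "C \<subseteq> cube n" and x: "x \<in> level n k" "x \<notin> C" and k: "k \<ge> 1"
    and b: "blocking n x C \<le> 1/2" and d: "k \<le> 2 * card {i \<in> x. x - {i} \<in> C}"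
  shows "real (card (hitting_walks n x C)) \<ge> fact n / (4 * real (n choose k))"
proof -
  let ?U = "{0..<n}"
  let ?A = "?U - x"
  let ?P = "\<lambda>q. \<forall>i\<le>n - k. ?U - set (take i q) \<notin> C"
  let ?Q = "\<lambda>r. x - {hd r} \<in> C"
  let ?I = "{i \<in> x. x - {i} \<in> C}"
  have xU: "x \<subseteq> ?U" and cx: "card x = k" and fx: "finite x"
    using x finite_subset[of x ?U] by (auto simp: level_def cube_def)
  have kn: "k \<le> n" using xU cx card_mono[of ?U x] by simp
  have cA: "card ?A = n - k" using xU cx fx by (simp add: card_Diff_subset)
  have Ux: "?U - ?A = x" using xU by auto
  have "hitting_walks n x C = {p \<in> permutations_of_set ?U. set (take (card ?A) p) = ?A \<and> ?P (take (card ?A) p) \<and> ?Q (drop (card ?A) p)}"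
  proof -
    have "walk_vertex n p (n - k) = x \<and> (\<forall>i\<le>n - k. walk_vertex n p i \<notin> C) \<and> walk_vertex n p (Suc (n - k)) \<in> C \<longleftrightarrow>
      set (take (n - k) p) = ?A \<and> ?P (take (n - k) p) \<and> ?Q (drop (n - k) p)" if p: "p \<in> permutations_of_set ?U" for p
    proof -
      have lp: "length p = n" using length_finite_permutations_of_set[OF p] by simp
      have 1: "walk_vertex n p (n - k) = x \<longleftrightarrow> set (take (n - k) p) = ?A"
        by (rule walk_vertex_eq_iff[OF p xU])
      have 2: "(\<forall>i\<le>n - k. walk_vertex n p i \<notin> C) \<longleftrightarrow> ?P (take (n - k) p)"
        by (auto simp: walk_vertex_def min_def)
      have 3: "walk_vertex n p (Suc (n - k)) = walk_vertex n p (n - k) - {hd (drop (n - k) p)}"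
        using lp kn k by (auto simp: walk_vertex_def take_Suc_conv_app_nth hd_drop_conv_nth)
      show ?thesis using 1 2 3 by auto
    qed
    then show ?thesis unfolding hitting_walks_def cx cA by blast
  qed
  then have "card (hitting_walks n x C) = card {q \<in> permutations_of_set ?A. ?P q} * card {r \<in> permutations_of_set x. ?Q r}"
    using card_permutations_split[of ?U ?A ?P ?Q] Ux by simp
  \<comment> \<open>As \<open>k >= 1\<close>, the list \<open>r\<close> is nonempty and its head
    lies in \<open>x\<close> automatically.\<close>
  also have "{r \<in> permutations_of_set x. ?Q r} = {r \<in> permutations_of_set x. hd r \<in> ?I}"
    using k cx by (auto simp: permutations_of_set_def intro!: hd_in_set)
  also have "card \<dots> = card ?I * fact (k - 1)"
    using card_permutations_hd[OF fx, of ?I] cx by simp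
  finally have eq: "real (card (hitting_walks n x C)) = real (card {q \<in> permutations_of_set ?A. ?P q}) * (real (card ?I) * fact (k - 1))"
    by simp
  have "fact n / (4 * real (n choose k)) = fact k * fact (n - k) / 4"
    using kn by (simp add: binomial_fact)
  also have "\<dots> = (fact (n - k) * (1/2)) * ((real k / 2) * fact (k - 1))"
    using k by (simp add: fact_reduce[of k])
  also have "\<dots> \<le> real (card {q \<in> permutations_of_set ?A. ?P q}) * (real (card ?I) * fact (k - 1))"
  proof (intro mult_mono)
    have "fact (n - k) * (1/2) \<le> (fact (n - k) * (1 - blocking n x C) :: real)" using b by (intro mult_left_mono) auto
    also have "\<dots> \<le> real (card {q \<in> permutations_of_set ?A. ?P q})"
      by (rule card_unblocked_prefixes[OF C x])
    finally show "fact (n - k) * (1/2) \<le> real (card {q \<in> permutations_of_set ?A. ?P q})" .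
  qed (use d in auto)
  finally show ?thesis using eq by simp
qed

section \<open>Survival of an empty set of vertices\<close>

lemma blocking_mono:
  assumes "finite C'" "C \<subseteq> C'" shows "blocking n x C \<le> blocking n x C'"
  unfolding blocking_def using assms by (intro sum_mono2) auto

lemma supported_mono: 
  assumes "C \<subseteq> C'" "supported n k C" shows "supported n k C'"
  unfolding supported_def
proof
  fix x assume x: "x \<in> level n k"
  have "finite x" using x finite_subset[of x "{0..<n}"] by (auto simp: level_def cube_def)
  then have "card {i \<in> x. x - {i} \<in> C} \<le> card {i \<in> x. x - {i} \<in> C'}"
    using assms(1) by (intro card_mono) auto
  then show "k \<le> 2 * card {i \<in> x. x - {i} \<in> C'}" using assms(2) x by (force simp: supported_def)
qed

text \<open>Every walk meets the top, so an occupied top alone contributes 1 > 1/2 to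
  \<open>blocking\<close>. Hence an unblocked process has not terminated.\<close>

lemma unblocked_top:
  assumes "unblocked n k C" "finite C" "k < n"
  shows "{0..<n} \<notin> C"
proof
  assume U: "{0..<n} \<in> C"
  have x: "{0..<k} \<in> level n k" using assms by (auto simp: level_def cube_def)
  have "{0..<k} \<subset> {0..<n}" using assms by auto
  then have "(\<Sum>z\<in>{{0..<n}}. 1 / real ((n - card {0..<k}) choose (card z - card {0..<k}))) \<le> blocking n {0..<k} C"
    unfolding blocking_def using U assms by (intro sum_mono2) auto
  moreover have "blocking n {0..<k} C \<le> 1/2" using assms x by (auto simp: unblocked_def)
  ultimately show False by simp
qed

text \<open>A walk has one vertex on level \<open>k\<close>, so the sets of hitting walks for
  different vertices of \<open>S\<close> are disjoint and the lower bounds from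
  \<open>card_hitting_walks\<close> add up.\<close>

lemma fill_step:
  assumes C: "cluster_valid n C" and un: "unblocked n k C" and su: "supported n k C"
    and S: "S \<subseteq> level n k" "S \<inter> C = {}" and k: "1 \<le> k" "k < n"
  shows "real (card {p \<in> permutations_of_set {0..<n}. S \<inter> dla_update C (walk_of n p) = {}})
    \<le> fact n * (1 - real (card S) / (4 * real (n choose k)))"
proof -
  let ?P = "permutations_of_set {0..<n}"
  let ?M = "{p \<in> ?P. S \<inter> dla_update C (walk_of n p) = {}}"
  have fC: "finite C" and Cc: "C \<subseteq> cube n" using C cluster_valid_finite by (auto simp: cluster_valid_def)
  have fS: "finite S" using S finite_level finite_subset by blast
  have cS: "card x = k" if "x \<in> S" for x using that S by (auto simp: level_def)
  have sub: "(\<Union>x\<in>S. hitting_walks n x C) \<subseteq> ?P - ?M"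
  proof (intro UN_least subsetI)
    fix x p assume x: "x \<in> S" and "p \<in> hitting_walks n x C"
    then have p: "p \<in> ?P" "walk_vertex n p (n - k) = x" "\<And>i. i \<le> n - k \<Longrightarrow> walk_vertex n p i \<notin> C"
      "walk_vertex n p (Suc (n - k)) \<in> C"
      using cS[OF x] by (auto simp: hitting_walks_def)
    have "dla_update C (walk_of n p) = insert x C"
      using dla_update_walk[OF p(1) _ p(3) p(4)] k p(2) by simp
    then show "p \<in> ?P - ?M" using x p by auto
  qed
  have "real (card S) * (fact n / (4 * real (n choose k))) \<le> (\<Sum>x\<in>S. real (card (hitting_walks n x C)))"
  proof -
    have "(\<Sum>x\<in>S. fact n / (4 * real (n choose k))) \<le> (\<Sum>x\<in>S. real (card (hitting_walks n x C)))"
    proof (rule sum_mono)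
      fix x assume x: "x \<in> S"
      then have xl: "x \<in> level n k" "x \<notin> C" using S by auto
      show "fact n / (4 * real (n choose k)) \<le> real (card (hitting_walks n x C))"
        by (rule card_hitting_walks[OF fC Cc xl k(1)]) (use un su xl in \<open>auto simp: unblocked_def supported_def\<close>)
    qed
    then show ?thesis by simp
  qed
  also have "\<dots> = real (card (\<Union>x\<in>S. hitting_walks n x C))"
  proof (subst card_UN_disjoint[OF fS])
    show "\<forall>x\<in>S. finite (hitting_walks n x C)" by (auto simp: hitting_walks_def)
    show "\<forall>x\<in>S. \<forall>y\<in>S. x \<noteq> y \<longrightarrow> hitting_walks n x C \<inter> hitting_walks n y C = {}"
      using cS by (auto simp: hitting_walks_def)
  qed simp
  also have "\<dots> \<le> real (card (?P - ?M))" using sub by (intro of_nat_mono card_mono) auto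
  also have "\<dots> = fact n - real (card ?M)"
  proof -
    have "card (?P - ?M) = card ?P - card ?M" by (intro card_Diff_subset) auto
    moreover have "card ?M \<le> card ?P" by (intro card_mono) auto
    ultimately show ?thesis by (simp add: of_nat_diff)
  qed
  finally show ?thesis by (simp add: algebra_simps)
qed

text \<open>\<open>unblocked\<close> is demanded only at the end, inside the event. Since it is a
  decreasing property, its failure at any earlier time makes the event impossible, so each step may
  assume it without conditioning. \<open>supported\<close> is increasing and is assumed at the
  start.\<close>

lemma fill_iterate:
  assumes S: "S \<subseteq> level n k" and k: "1 \<le> k" "k < n" and C: "cluster_valid n C" "supported n k C"
  shows "(estep n ^^ t) (\<lambda>C. of_bool (S \<inter> C = {} \<and> unblocked n k C)) C
    \<le> (1 - real (card S) / (4 * real (n choose k))) ^ t"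
  using C
proof (induction t arbitrary: C)
  case 0
  then show ?case by simp
next
  case (Suc t)
  let ?f = "\<lambda>C. of_bool (S \<inter> C = {} \<and> unblocked n k C) :: real"
  let ?P = "permutations_of_set {0..<n}"
  define q where "q = 1 - real (card S) / (4 * real (n choose k))"
  have "card S \<le> n choose k" using S card_mono[OF finite_level S] by (simp add: card_level)
  then have q0: "q \<ge> 0" using k by (simp add: q_def field_simps)
  have anti: "?f C' \<le> ?f C" if "cluster_valid n C" "cluster_valid n C'" "C \<subseteq> C'" for C C'
  proof -
    have "unblocked n k C' \<Longrightarrow> unblocked n k C"
      using blocking_mono[OF cluster_valid_finite[OF that(2)] that(3)] unfolding unblocked_def
      by (meson order_trans)
    then show ?thesis using that by auto
  qed
  have le: "(estep n ^^ s) ?f C \<le> ?f C" if "cluster_valid n C" for C s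
    by (rule estep_iterate_le_initial[OF anti that])
  show ?case
  proof (cases "S \<inter> C = {} \<and> unblocked n k C")
    case False
    then have "?f C = 0" by simp
    then have "(estep n ^^ Suc t) ?f C \<le> 0" using le[OF Suc.prems(1), of "Suc t"] by linarith
    also have "0 \<le> q ^ Suc t" using q0 by simp
    finally show ?thesis unfolding q_def .
  next
    case True
    have top: "{0..<n} \<notin> C"
      by (rule unblocked_top) (use True Suc.prems k cluster_valid_finite in auto)
    have "(estep n ^^ t) ?f (dla_update C (walk_of n p)) \<le> of_bool (S \<inter> dla_update C (walk_of n p) = {}) * q ^ t"
      if p: "p \<in> ?P" for p
    proof -
      let ?C = "dla_update C (walk_of n p)"
      have v: "cluster_valid n ?C" by (rule cluster_valid_update[OF Suc.prems(1) top p])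
      have s: "supported n k ?C" by (rule supported_mono[OF dla_update_superset Suc.prems(2)])
      show ?thesis
      proof (cases "S \<inter> ?C = {}")
        case True
        then show ?thesis using Suc.IH[OF v s] by (simp add: q_def)
      next
        case False
        then show ?thesis using le[OF v, of t] by simp
      qed
    qed
    then have "(\<Sum>p\<in>?P. (estep n ^^ t) ?f (dla_update C (walk_of n p)))
        \<le> (\<Sum>p\<in>?P. of_bool (S \<inter> dla_update C (walk_of n p) = {}) * q ^ t)" by (rule sum_mono)
    also have "\<dots> = real (card {p \<in> ?P. S \<inter> dla_update C (walk_of n p) = {}}) * q ^ t"
      by (simp add: sum_of_bool_real del: sum_of_bool_eq flip: sum_distrib_right)
    also have "\<dots> \<le> (fact n * q) * q ^ t"
      using fill_step[OF Suc.prems(1) _ Suc.prems(2) S _ k] True q0 unfolding q_def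
      by (intro mult_right_mono) auto
    finally have "estep n ((estep n ^^ t) ?f) C \<le> q * q ^ t"
      using top by (simp add: estep_def field_simps)
    then show ?thesis by (simp add: q_def)
  qed
qed

text \<open>Markov property at time \<open>a\<close>: either the cluster is then unsupported, or
  \<open>fill_iterate\<close> applies to each \<open>S\<close> over the remaining \<open>b\<close>
  steps, with 1 - r <= exp (-r).\<close>

lemma dla_prob_unfilled:
  assumes F: "finite F" "\<And>S. S \<in> F \<Longrightarrow> S \<subseteq> level n k" and k: "1 \<le> k" "k < n"
  shows "dla_prob n (a + b) (\<lambda>C. (\<exists>S\<in>F. S \<inter> C = {}) \<and> unblocked n k C)
    \<le> dla_prob n a (\<lambda>C. \<not> supported n k C)
      + (\<Sum>S\<in>F. exp (- real (card S) * real b / (4 * real (n choose k))))"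
proof -
  define q where "q = (\<Sum>S\<in>F. exp (- real (card S) * real b / (4 * real (n choose k))))"
  have q0: "q \<ge> 0" by (simp add: q_def sum_nonneg)
  let ?f = "\<lambda>C. of_bool ((\<exists>S\<in>F. S \<inter> C = {}) \<and> unblocked n k C) :: real"
  have "(estep n ^^ b) ?f C \<le> 1 * of_bool (\<not> supported n k C) + 1 * q" if C: "cluster_valid n C" for C
  proof (cases "supported n k C")
    case False
    have "(estep n ^^ b) ?f C \<le> (estep n ^^ b) (\<lambda>_. 1) C" by (rule estep_iterate_mono[OF _ C]) auto
    then show ?thesis using False q0 by (simp add: estep_iterate_const)
  next
    case True
    have "(estep n ^^ b) ?f C \<le> (estep n ^^ b) (\<lambda>C. \<Sum>S\<in>F. of_bool (S \<inter> C = {} \<and> unblocked n k C)) C"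
    proof (rule estep_iterate_mono[OF _ C])
      fix C
      have "of_bool (S \<inter> C = {} \<and> unblocked n k C) \<le> (\<Sum>S\<in>F. of_bool (S \<inter> C = {} \<and> unblocked n k C) :: real)"
        if "S \<in> F" for S
        using F that by (intro member_le_sum) auto
      moreover have "(0::real) \<le> (\<Sum>S\<in>F. of_bool (S \<inter> C = {} \<and> unblocked n k C))" by (intro sum_nonneg) simp
      ultimately show "?f C \<le> (\<Sum>S\<in>F. of_bool (S \<inter> C = {} \<and> unblocked n k C))" by fastforce
    qed
    also have "\<dots> = (\<Sum>S\<in>F. (estep n ^^ b) (\<lambda>C. of_bool (S \<inter> C = {} \<and> unblocked n k C)) C)"
      by (subst estep_iterate_sum[OF F(1)]) (rule refl)
    also have "\<dots> \<le> q"
      unfolding q_def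
    proof (rule sum_mono)
      fix S assume S: "S \<in> F"
      let ?r = "real (card S) / (4 * real (n choose k))"
      have "card S \<le> n choose k" using F(2)[OF S] card_mono[OF finite_level, of S] by (simp add: card_level)
      then have r: "?r \<le> 1" using k by (simp add: field_simps)
      have "(estep n ^^ b) (\<lambda>C. of_bool (S \<inter> C = {} \<and> unblocked n k C)) C \<le> (1 - ?r) ^ b"
        by (rule fill_iterate[OF F(2)[OF S] k C True])
      also have "\<dots> \<le> exp (- ?r) ^ b"
        using r exp_ge_add_one_self[of "- ?r"] by (intro power_mono) auto
      also have "\<dots> = exp (- real (card S) * real b / (4 * real (n choose k)))"
        by (simp add: exp_of_nat_mult[symmetric] mult.commute)
      finally show "(estep n ^^ b) (\<lambda>C. of_bool (S \<inter> C = {} \<and> unblocked n k C)) C \<le> \<dots>" .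
    qed
    finally show ?thesis using True by simp
  qed
  then have "(estep n ^^ a) ((estep n ^^ b) ?f) {{}} \<le> (estep n ^^ a) (\<lambda>C. 1 * of_bool (\<not> supported n k C) + 1 * q) {{}}"
    by (rule estep_iterate_mono[OF _ cluster_valid_initial])
  also have "\<dots> = dla_prob n a (\<lambda>C. \<not> supported n k C) + q"
    by (subst estep_iterate_linear) (simp add: dla_prob_def estep_iterate_const)
  finally show ?thesis by (simp add: dla_prob_def funpow_add q_def)
qed

subsection \<open>Stages\<close>

lemma binomial_Suc_ratio: "real (n choose Suc m) * real (Suc m) = real (n choose m) * real (n - m)"
proof -
  have "(n choose Suc m) * Suc m = (n choose m) * (n - m)"
    using binomial_absorb_comp[of n m] binomial_absorption[of m n] by (cases n) (auto simp: algebra_simps)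
  then show ?thesis by (metis of_nat_mult)
qed

text \<open>Up to level n / 4 the ratio (n - m) / (m + 1) of consecutive coefficients is at least
  3.\<close>

lemma binomial_growth:
  assumes "4 * (m + j) \<le> n"
  shows "3 ^ j * real (n choose m) \<le> real (n choose (m + j))"
  using assms
proof (induction j)
  case (Suc j)
  let ?m = "m + j"
  have "3 * real (Suc ?m) \<le> real (n - ?m)" using Suc.prems by (simp add: of_nat_diff)
  then have "real (n choose ?m) * (3 * real (Suc ?m)) \<le> real (n choose ?m) * real (n - ?m)"
    by (intro mult_left_mono) auto
  also have "\<dots> = real (n choose Suc ?m) * real (Suc ?m)" by (simp only: binomial_Suc_ratio)
  finally have "(3 * real (n choose ?m)) * real (Suc ?m) \<le> real (n choose Suc ?m) * real (Suc ?m)"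
    by (simp only: mult_ac)
  then have "3 * real (n choose ?m) \<le> real (n choose Suc ?m)"
    by (rule mult_right_le_imp_le) simp
  moreover have "3 ^ j * real (n choose m) \<le> real (n choose ?m)" using Suc by simp
  ultimately show ?case by simp
qed simp

text \<open>A single term of the expansion of (1 + x)^n is at most exp (x n). The parameter
  \<open>x\<close> is chosen later: 1/1000 for levels, n powr (-K) for families of deficient
  sets.\<close>

lemma binomial_le_exp_div_power:
  assumes x: "x > 0"
  shows "real (n choose k) \<le> exp (x * real n) / x ^ k"
proof (cases "k \<le> n")
  case True
  define f where "f = (\<lambda>i. real (n choose i) * x ^ i)"
  have "f k \<le> (\<Sum>i\<le>n. f i)"
    using True x by (intro member_le_sum) (auto simp: f_def)
  also have "\<dots> = (x + 1) ^ n" unfolding binomial_ring by (simp add: f_def)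
  also have "\<dots> \<le> exp x ^ n" using exp_ge_add_one_self[of x] x by (intro power_mono) (auto simp: add.commute)
  also have "\<dots> = exp (x * real n)" by (simp add: exp_of_nat_mult[symmetric] mult.commute)
  finally show ?thesis using x by (simp add: f_def field_simps)
qed (use x in \<open>simp add: binomial_eq_0\<close>)

text \<open>The choice x = 1/1000 costs exp (n / 1000), and 1000^k <= exp (10 k) costs no more
  because k <= n / 10000.\<close>

lemma binomial_le_exp:
  assumes "10000 * k \<le> n"
  shows "real (n choose k) \<le> exp (real n / 500)"
proof -
  have "real (n choose k) \<le> exp (real n / 1000) * 1000 ^ k"
    using binomial_le_exp_div_power[of "1/1000" n k] by (simp add: field_simps)
  also have "(1000::real) ^ k \<le> exp 10 ^ k"
  proof (intro power_mono)
    have "(2::real) ^ 10 \<le> exp 1 ^ 10" using exp_ge_add_one_self[of 1] by (intro power_mono) auto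
    also have "\<dots> = exp (10::real)" by (simp add: exp_of_nat_mult[symmetric])
    finally show "(1000::real) \<le> exp 10" by simp
  qed simp
  also have "\<dots> = exp (10 * real k)" by (simp add: exp_of_nat_mult[symmetric] mult.commute)
  also have "\<dots> \<le> exp (real n / 1000)" using assms by simp
  finally have "real (n choose k) \<le> exp (real n / 1000) * exp (real n / 1000)" by simp
  also have "\<dots> = exp (real n / 500)" by (simp flip: exp_add)
  finally show ?thesis .
qed

section \<open>Stage times and the sparse levels above the current one\<close>

definition stage_time :: "nat \<Rightarrow> nat \<Rightarrow> nat" where
  "stage_time n k = (n choose Suc k) div 10"

lemma stage_time_le: "real (stage_time n k) \<le> real (n choose Suc k) / 10"
  unfolding stage_time_def by (simp add: le_divide_eq flip: of_nat_mult)

lemma stage_time_le_pow2: "stage_time n k \<le> 2 ^ n"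
proof -
  have "stage_time n k \<le> n choose Suc k" by (simp add: stage_time_def)
  also have "\<dots> \<le> 2 ^ n" by (rule binomial_le_pow2)
  finally show ?thesis .
qed

text \<open>Passing from level k + 1 + i to the next multiplies the bound by T / (n choose (k + 1 +
  i)) <= 3^(-i); the product of these factors has a triangular number as exponent.\<close>

lemma expectation_card_level_stage:
  assumes "k + i \<le> n div 4" "t \<le> stage_time n k" "n > 0"
  shows "(estep n ^^ t) (\<lambda>C. real (card (level n (Suc (k + i)) \<inter> C))) {{}}
    \<le> real (stage_time n k) * (1/3) ^ (\<Sum>j<i. j)"
  using assms
proof (induction i arbitrary: t)
  case 0
  then show ?case using expectation_card_level_le_time[of k n t "stage_time n k"] by simp
next
  case (Suc i)
  let ?T = "real (stage_time n k)"
  let ?b = "?T * (1/3) ^ (\<Sum>j<i. j)"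
  let ?m = "Suc (k + i)"
  have "(estep n ^^ t) (\<lambda>C. real (card (level n (Suc ?m) \<inter> C))) {{}} \<le> real t * ?b / real (n choose ?m)"
    by (rule expectation_card_level_rec[where T = "stage_time n k"]) (use Suc in auto)
  also have "\<dots> \<le> ?T * ?b / real (n choose ?m)"
    using Suc.prems by (intro divide_right_mono mult_right_mono) auto
  also have "\<dots> = ?b * (?T / real (n choose ?m))" by simp
  also have "\<dots> \<le> ?b * (1/3) ^ i"
  proof (intro mult_left_mono)
    have "3 ^ i * real (n choose Suc k) \<le> real (n choose ?m)"
      using binomial_growth[of "Suc k" i n] Suc.prems by simp
    moreover have "?T \<le> real (n choose Suc k)" using stage_time_le[of n k] by simp
    ultimately have "3 ^ i * ?T \<le> real (n choose ?m)"
      by (smt (verit) mult_left_mono zero_le_power)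
    moreover have "real (n choose ?m) > 0" using Suc.prems by simp
    ultimately show "?T / real (n choose ?m) \<le> (1/3) ^ i" by (simp add: field_simps)
  qed simp
  also have "\<dots> = ?T * (1/3) ^ (\<Sum>j<Suc i. j)" by (simp add: power_add)
  finally show ?case by simp
qed

text \<open>By validity, reaching beyond level n / 4 forces an occupied vertex on level
  \<open>n div 4 + 1\<close>. Its expected number is at most 2^n times 3 to a negative quadratic
  power, and Markov's inequality applies.\<close>

lemma dla_prob_high_level:
  assumes n: "10000 * Suc k \<le> n"
  shows "dla_prob n (stage_time n k) (\<lambda>C. \<exists>z\<in>C. card z > n div 4) \<le> exp (- real n)"
proof -
  let ?h = "n div 4"
  define i where "i = ?h - k"
  have i: "k + i = ?h" "5 * i \<ge> n" using n by (auto simp: i_def)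
  let ?X = "\<lambda>C. real (card (level n (Suc (k + i)) \<inter> C))"
  have "dla_prob n (stage_time n k) (\<lambda>C. \<exists>z\<in>C. card z > ?h) \<le> (estep n ^^ stage_time n k) ?X {{}}"
  proof (rule dla_prob_le_expectation)
    fix C assume C: "cluster_valid n C"
    show "of_bool (\<exists>z\<in>C. card z > ?h) \<le> ?X C"
    proof (cases "\<exists>z\<in>C. card z > ?h")
      case True
      then obtain z where z: "z \<in> C" "Suc ?h \<le> card z" by auto
      then obtain w where w: "w \<in> C" "card w = Suc ?h"
        using C unfolding cluster_valid_def by blast
      then have "w \<in> level n (Suc (k + i)) \<inter> C" using C i by (auto simp: level_def cluster_valid_def)
      then have "card (level n (Suc (k + i)) \<inter> C) \<noteq> 0" using finite_level[of n] by auto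
      then show ?thesis using True by simp
    qed simp
  qed
  also have "\<dots> \<le> real (stage_time n k) * (1/3) ^ (\<Sum>j<i. j)"
    by (rule expectation_card_level_stage) (use i n in auto)
  also have "\<dots> \<le> 2 ^ n * (1/3) ^ (2 * n)"
  proof (intro mult_mono power_decreasing)
    show "real (stage_time n k) \<le> 2 ^ n"
      using stage_time_le_pow2[of n k] by (metis of_nat_le_iff of_nat_numeral of_nat_power)
    have s: "2 * (\<Sum>j<i. j) = i * (i - 1)"
    proof (induction i)
      case (Suc i)
      then show ?case by (cases i) (auto simp: algebra_simps)
    qed simp
    \<comment> \<open>The exponent i (i - 1) / 2 is at least 10 i >= 2 n, which already suffices
      because 2/9 <= exp (-1).\<close>
    have "20 \<le> i - 1" using i n by auto
    then have "i * 20 \<le> i * (i - 1)" by (rule mult_le_mono2)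
    then have "4 * n \<le> i * (i - 1)" using i by linarith
    then show "2 * n \<le> (\<Sum>j<i. j)" using s by linarith
  qed auto
  also have "\<dots> = (2/9) ^ n" by (simp add: power_mult power_mult_distrib[symmetric] power2_eq_square)
  also have "\<dots> \<le> exp (-1) ^ n"
  proof (intro power_mono)
    have "exp (1::real) \<le> 3" by (rule exp_le)
    then show "2/9 \<le> exp (-1::real)" by (simp add: exp_minus field_simps)
  qed simp
  also have "\<dots> = exp (- real n)" by (simp add: exp_of_nat_mult[symmetric])
  finally show ?thesis .
qed

section \<open>Bounding the blocking probability\<close>

lemma card_supersets_level:
  assumes x: "x \<in> level n k" and m: "k \<le> m"
  shows "card {z \<in> level n m. x \<subseteq> z} = (n - k) choose (m - k)"
proof -
  have xU: "x \<subseteq> {0..<n}" and cx: "card x = k" and fx: "finite x"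
    using x finite_subset[of x "{0..<n}"] by (auto simp: level_def cube_def)
  let ?B = "{w. w \<subseteq> {0..<n} - x \<and> card w = m - k}"
  have "bij_betw (\<lambda>w. x \<union> w) ?B {z \<in> level n m. x \<subseteq> z}"
  proof (rule bij_betwI[where g = "\<lambda>z. z - x"])
    show "(\<lambda>w. x \<union> w) \<in> ?B \<rightarrow> {z \<in> level n m. x \<subseteq> z}"
    proof (rule Pi_I)
      fix w assume w: "w \<in> ?B"
      then have "finite w" "x \<inter> w = {}" using finite_subset[of w "{0..<n} - x"] by auto
      then show "x \<union> w \<in> {z \<in> level n m. x \<subseteq> z}"
        using w xU cx fx m by (auto simp: level_def cube_def card_Un_disjoint)
    qed
    show "(\<lambda>z. z - x) \<in> {z \<in> level n m. x \<subseteq> z} \<rightarrow> ?B"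
      using cx fx by (auto simp: level_def cube_def card_Diff_subset)
  qed auto
  then have "card ?B = card {z \<in> level n m. x \<subseteq> z}" by (rule bij_betw_same_card)
  moreover have "card ?B = card ({0..<n} - x) choose (m - k)" by (rule n_subsets) simp
  ultimately show ?thesis using xU cx fx by (simp add: card_Diff_subset)
qed

text \<open>The terms decay at least like a geometric series of ratio 1/3, whose sum is 3/2.\<close>

lemma sum_inverse_binomial_le:
  assumes "4 * h \<le> n"
  shows "(\<Sum>m=Suc k..h. 1 / real (n choose m)) \<le> 3 / (2 * real (n choose Suc k))"
proof (cases "Suc k \<le> h")
  case True
  have pos: "real (n choose Suc k) > 0" using assms True by simp
  have "(\<Sum>m=Suc k..h. 1 / real (n choose m)) \<le> (\<Sum>m=Suc k..h. (1/3) ^ (m - Suc k) / real (n choose Suc k))"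
  proof (rule sum_mono)
    fix m assume m: "m \<in> {Suc k..h}"
    obtain j where j: "m = Suc k + j" using m le_Suc_ex[of "Suc k" m] by auto
    have "3 ^ (m - Suc k) * real (n choose Suc k) \<le> real (n choose m)"
      using binomial_growth[of "Suc k" j n] m assms unfolding j by simp
    moreover have "real (n choose m) > 0" using m assms by simp
    ultimately show "1 / real (n choose m) \<le> (1/3) ^ (m - Suc k) / real (n choose Suc k)"
      using pos by (simp add: field_simps)
  qed
  also have "\<dots> = (\<Sum>m=Suc k..h. (1/3) ^ (m - Suc k)) / real (n choose Suc k)"
    by (simp add: sum_divide_distrib)
  also have "(\<Sum>m=Suc k..h. (1/3::real) ^ (m - Suc k)) = (\<Sum>j<h - k. (1/3) ^ j)"
    by (rule sum.reindex_bij_witness[of _ "\<lambda>j. j + Suc k" "\<lambda>m. m - Suc k"]) auto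
  also have "\<dots> \<le> 3/2"
  proof -
    have "(\<Sum>j<d. (1/3::real) ^ j) = 3/2 - 3/2 * (1/3) ^ d" for d by (induction d) auto
    then show ?thesis by simp
  qed
  finally show ?thesis using pos by (simp add: divide_right_mono)
qed simp

text \<open>Unimodality and symmetry of the row; this keeps the rescaled weights below at most
  1.\<close>

lemma binomial_ge_self:
  assumes "1 \<le> j" "j < N" shows "N \<le> N choose j"
proof -
  have "N choose 1 \<le> N choose j"
  proof (cases "2 * j \<le> N")
    case True
    then show ?thesis by (intro binomial_mono) (use assms in auto)
  next
    case False
    then have "N choose 1 \<le> N choose (N - j)" by (intro binomial_mono) (use assms in auto)
    also have "\<dots> = N choose j" using assms by (simp add: binomial_symmetric[of j N])
    finally show ?thesis .
  qed
  then show ?thesis by simp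
qed

text \<open>The Chernoff bound with the weights of \<open>blocking\<close> scaled by
  \<open>n - k\<close>, which keeps each of them in [0, 1], so that exp u - 1 <= 2 u. The exponent
  is then at most 3/10 (n - k), against the threshold (n - k) / 2.\<close>

lemma dla_prob_blocking_low:
  assumes n: "10000 * Suc k \<le> n" and x: "x \<in> level n k"
  shows "dla_prob n (stage_time n k)
    (\<lambda>C. 1/2 < (\<Sum>z\<in>{z \<in> cube n. x \<subset> z \<and> card z \<le> n div 4} \<inter> C. 1 / real ((n - k) choose (card z - k))))
    \<le> exp (- real (n - k) / 5)"
proof -
  let ?h = "n div 4"
  let ?Z = "{z \<in> cube n. x \<subset> z \<and> card z \<le> ?h}"
  let ?w = "\<lambda>z. 1 / real ((n - k) choose (card z - k))"
  let ?u = "\<lambda>z. real (n - k) * ?w z"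
  let ?T = "stage_time n k"
  have cx: "card x = k" using x by (auto simp: level_def)
  have zk: "k < card z" if "z \<in> ?Z" for z
    using that psubset_card_mono[of z x] finite_subset[of z "{0..<n}"] cx by (auto simp: cube_def)
  have "dla_prob n ?T (\<lambda>C. 1/2 < (\<Sum>z\<in>?Z \<inter> C. ?w z))
      \<le> dla_prob n ?T (\<lambda>C. real (n - k) / 2 \<le> (\<Sum>z\<in>?Z \<inter> C. ?u z))"
  proof (rule dla_prob_mono)
    fix C assume "1/2 < (\<Sum>z\<in>?Z \<inter> C. ?w z)"
    then have "real (n - k) * (1/2) \<le> real (n - k) * (\<Sum>z\<in>?Z \<inter> C. ?w z)" by (intro mult_left_mono) auto
    then show "real (n - k) / 2 \<le> (\<Sum>z\<in>?Z \<inter> C. ?u z)" by (simp add: sum_distrib_left)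
  qed
  also have "\<dots> \<le> exp (real ?T * (\<Sum>z\<in>?Z. (exp (?u z) - 1) / real (n choose card z)) - real (n - k) / 2)"
    by (rule dla_prob_weight_tail) (auto simp: cube_def)
  also have "\<dots> \<le> exp (- real (n - k) / 5)"
  proof -
    have ZU: "?Z = (\<Union>m\<in>{Suc k..?h}. {z \<in> level n m. x \<subseteq> z})"
    proof (rule set_eqI, rule iffI)
      fix z assume z: "z \<in> ?Z"
      then show "z \<in> (\<Union>m\<in>{Suc k..?h}. {z \<in> level n m. x \<subseteq> z})"
        using zk[OF z] by (auto simp: level_def)
    qed (use cx in \<open>auto simp: level_def\<close>)
    have "(\<Sum>z\<in>?Z. (exp (?u z) - 1) / real (n choose card z)) \<le> (\<Sum>z\<in>?Z. 2 * ?u z / real (n choose card z))"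
    proof (intro sum_mono divide_right_mono)
      fix z assume z: "z \<in> ?Z"
      have a: "n - k \<le> (n - k) choose (card z - k)"
        by (rule binomial_ge_self) (use z zk[OF z] n in auto)
      moreover have "n - k > 0" using n by simp
      ultimately have "0 < (n - k) choose (card z - k)" by linarith
      with a have "0 < real ((n - k) choose (card z - k))" "real (n - k) \<le> real ((n - k) choose (card z - k))"
        by (simp_all only: of_nat_0_less_iff of_nat_le_iff)
      then have u: "0 \<le> ?u z" "?u z \<le> 1" by (simp_all only: mult_1_right times_divide_eq_right divide_le_eq_1_pos) simp_all
      have "exp (?u z) \<le> 1 + ?u z + (?u z)\<^sup>2" by (rule exp_bound[OF u])
      also have "(?u z)\<^sup>2 \<le> ?u z" using mult_left_mono[OF u(2) u(1)] by (simp add: power2_eq_square)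
      finally show "exp (?u z) - 1 \<le> 2 * ?u z" by simp
    qed simp
    also have "(\<Sum>z\<in>?Z. 2 * ?u z / real (n choose card z))
        = (\<Sum>m=Suc k..?h. \<Sum>z\<in>{z \<in> level n m. x \<subseteq> z}. 2 * ?u z / real (n choose card z))"
      unfolding ZU by (rule sum.UNION_disjoint) (auto simp: finite_level, auto simp: level_def)
    also have "\<dots> = (\<Sum>m=Suc k..?h. 2 * real (n - k) * (1 / real (n choose m)))"
    proof (rule sum.cong[OF refl])
      fix m assume m: "m \<in> {Suc k..?h}"
      have "(\<Sum>z\<in>{z \<in> level n m. x \<subseteq> z}. 2 * ?u z / real (n choose card z))
          = (\<Sum>z\<in>{z \<in> level n m. x \<subseteq> z}. 2 * (real (n - k) * (1 / real ((n - k) choose (m - k)))) / real (n choose m))"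
        by (rule sum.cong) (auto simp: level_def)
      also have "\<dots> = 2 * real (n - k) * (1 / real (n choose m))"
      \<comment> \<open>The number of supersets of \<open>x\<close> on level \<open>m\<close>
        cancels the denominator of their common weight, so each level contributes total weight
        \<open>n - k\<close>.\<close>
      proof -
        have "(n - k) choose (m - k) > 0" using m by (intro zero_less_binomial) auto
        then show ?thesis using m card_supersets_level[OF x, of m] by simp
      qed
      finally show "(\<Sum>z\<in>{z \<in> level n m. x \<subseteq> z}. 2 * ?u z / real (n choose card z)) = \<dots>" .
    qed
    also have "\<dots> = 2 * real (n - k) * (\<Sum>m=Suc k..?h. 1 / real (n choose m))"
      by (simp add: sum_distrib_left)
    also have "\<dots> \<le> 2 * real (n - k) * (3 / (2 * real (n choose Suc k)))"
      by (intro mult_left_mono sum_inverse_binomial_le) auto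
    finally have "real ?T * (\<Sum>z\<in>?Z. (exp (?u z) - 1) / real (n choose card z))
        \<le> (real (n choose Suc k) / 10) * (2 * real (n - k) * (3 / (2 * real (n choose Suc k))))"
      using stage_time_le[of n k] by (intro mult_mono) (auto intro!: sum_nonneg)
    \<comment> \<open>The divisor 10 in \<open>stage_time\<close> produces this 3/10; the gap to 1/2
      is the rate 1/5.\<close>
    also have "\<dots> = 3/10 * real (n - k)" using n by simp
    finally show ?thesis by simp
  qed
  finally show ?thesis .
qed

text \<open>Occupied vertices above level n / 4 are excluded separately; for the rest, a union bound
  over at most exp (n / 500) vertices \<open>x\<close> is affordable against exp (- (n - k) /
  5).\<close>

lemma dla_prob_blocked:
  assumes n: "10000 * Suc k \<le> n"
  shows "dla_prob n (stage_time n k) (\<lambda>C. \<not> unblocked n k C) \<le> 2 * exp (- real n / 10)"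
proof -
  let ?h = "n div 4"
  let ?T = "stage_time n k"
  let ?Z = "\<lambda>x. {z \<in> cube n. x \<subset> z \<and> card z \<le> ?h}"
  let ?B = "\<lambda>x C. 1/2 < (\<Sum>z\<in>?Z x \<inter> C. 1 / real ((n - k) choose (card z - k)))"
  have "dla_prob n ?T (\<lambda>C. \<not> unblocked n k C)
      \<le> dla_prob n ?T (\<lambda>C. (\<exists>z\<in>C. card z > ?h) \<or> (\<exists>x\<in>level n k. ?B x C))"
  proof (rule dla_prob_mono)
    fix C assume C: "cluster_valid n C" and "\<not> unblocked n k C"
    then obtain x where x: "x \<in> level n k" "blocking n x C > 1/2" by (force simp: unblocked_def)
    show "(\<exists>z\<in>C. card z > ?h) \<or> (\<exists>x\<in>level n k. ?B x C)"
    proof (cases "\<exists>z\<in>C. card z > ?h")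
      case False
      then have "{z \<in> C. x \<subset> z} = ?Z x \<inter> C" using C by (auto simp: cluster_valid_def)
      then have "?B x C" using x by (simp add: blocking_def level_def)
      then show ?thesis using x by blast
    qed simp
  qed
  also have "\<dots> \<le> dla_prob n ?T (\<lambda>C. \<exists>z\<in>C. card z > ?h) + dla_prob n ?T (\<lambda>C. \<exists>x\<in>level n k. ?B x C)"
    by (rule dla_prob_disj)
  also have "\<dots> \<le> exp (- real n) + (\<Sum>x\<in>level n k. exp (- real (n - k) / 5))"
    by (intro add_mono dla_prob_high_level[OF n] order_trans[OF dla_prob_bex[OF finite_level]] sum_mono dla_prob_blocking_low[OF n])
  also have "(\<Sum>x\<in>level n k. exp (- real (n - k) / 5)) \<le> exp (real n / 500) * exp (- real (n - k) / 5)"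
    using binomial_le_exp[of k n] n by (simp add: card_level)
  also have "\<dots> = exp (real n / 500 - real (n - k) / 5)" by (simp flip: exp_add)
  also have "\<dots> \<le> exp (- real n / 10)"
  proof -
    have "10000 * k \<le> n" using n by simp
    then have "10000 * real k \<le> real n" by linarith
    then have "real n / 500 - real (n - k) / 5 \<le> - real n / 10" by linarith
    then show ?thesis by simp
  qed
  also have "exp (- real n) \<le> exp (- real n / 10)" by simp
  finally show ?thesis by simp
qed

section \<open>Duration of a stage and induction over the stages\<close>

lemma stage_time_increment:
  assumes n: "10000 * Suc k \<le> n" and k: "k \<ge> 1"
  obtains b where "stage_time n k = stage_time n (k - 1) + b"
    "real b / (4 * real (n choose k)) \<ge> real n / (41 * real (Suc k))"
proof -
  let ?N = "real (n choose k)"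
  have N: "?N \<ge> 1" using n by (simp add: Suc_le_eq)
  have y: "real n / real (Suc k) \<ge> 10000" using n by (simp add: field_simps)
  have ratio: "real (n choose Suc k) = ?N * (real (n - k) / real (Suc k))"
    using binomial_Suc_ratio[of n k] by (simp add: field_simps)
  have low: "real (stage_time n k) \<ge> real (n choose Suc k) / 10 - 1"
    unfolding stage_time_def by linarith
  have up: "real (stage_time n (k - 1)) \<le> ?N / 10" using stage_time_le[of n "k - 1"] k by simp
  have nk: "real (n - k) / real (Suc k) \<ge> (9999/10000) * (real n / real (Suc k))"
  proof -
    have "10000 * k \<le> n" using n by simp
    then have "10000 * real k \<le> real n" by linarith
    then have "9999/10000 * real n \<le> real (n - k)" using n by (simp add: of_nat_diff)
    then have "9999/10000 * real n / real (Suc k) \<le> real (n - k) / real (Suc k)" by (rule divide_right_mono) simp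
    then show ?thesis by simp
  qed
  \<comment> \<open>As (n choose (k + 1)) is (n choose k) times (n - k) / (k + 1), the ideal
    constant would be 40. The loss 11/10 consists of 1/10 for the preceding stage time and 1 for
    rounding; with n / (k + 1) >= 10000 the constant 41 absorbs it.\<close>
  have main: "real (stage_time n k) - real (stage_time n (k - 1)) \<ge> ?N * (4 * (real n / (41 * real (Suc k))))"
  proof -
    have "?N * (4 * (real n / (41 * real (Suc k)))) = ?N * (4/41 * (real n / real (Suc k)))" by simp
    also have "\<dots> \<le> ?N * ((9999/10000) * (real n / real (Suc k)) / 10 - 11/10)"
    proof (rule mult_left_mono)
      have "4/41 * y \<le> (9999/10000) * y / 10 - 11/10" if "y \<ge> 10000" for y :: real
        using that by linarith
      from this[OF y] show "4/41 * (real n / real (Suc k)) \<le> (9999/10000) * (real n / real (Suc k)) / 10 - 11/10" .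
    qed simp
    also have "\<dots> \<le> ?N * (real (n - k) / real (Suc k) / 10 - 11/10)"
    proof (rule mult_left_mono)
      show "(9999/10000) * (real n / real (Suc k)) / 10 - 11/10 \<le> real (n - k) / real (Suc k) / 10 - 11/10"
        using nk by (intro diff_right_mono divide_right_mono) auto
    qed simp
    also have "\<dots> = real (n choose Suc k) / 10 - ?N - ?N / 10" unfolding ratio by (simp add: algebra_simps)
    also have "\<dots> \<le> real (stage_time n k) - real (stage_time n (k - 1))" using low up N by simp
    finally show ?thesis .
  qed
  have "0 \<le> ?N * (4 * (real n / (41 * real (Suc k))))" by simp
  then have "real (stage_time n (k - 1)) \<le> real (stage_time n k)" using main by linarith
  then have "stage_time n (k - 1) \<le> stage_time n k" by (simp only: of_nat_le_iff)
  then obtain b where b: "stage_time n k = stage_time n (k - 1) + b" using le_Suc_ex by blast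
  show ?thesis
  proof (rule that[OF b])
    show "real b / (4 * ?N) \<ge> real n / (41 * real (Suc k))" 
    proof -
      have "(real n / (41 * real (Suc k))) * (4 * ?N) \<le> real b" using main b by (simp add: mult_ac)
      then show ?thesis using n by (subst pos_le_divide_eq) auto
    qed
  qed
qed

text \<open>The event is split by whether the cluster is unblocked at the end of the stage, the form
  that \<open>dla_prob_unfilled\<close> needs.\<close>

lemma dla_prob_unfilled_stage:
  assumes n: "10000 * Suc k \<le> n" and k: "k \<ge> 1"
    and F: "finite F" "\<And>S. S \<in> F \<Longrightarrow> S \<subseteq> level n k"
  shows "dla_prob n (stage_time n k) (\<lambda>C. \<exists>S\<in>F. S \<inter> C = {})
    \<le> dla_prob n (stage_time n (k - 1)) (\<lambda>C. \<not> supported n k C) + 2 * exp (- real n / 10)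
      + (\<Sum>S\<in>F. exp (- real (card S) * (real n / (41 * real (Suc k)))))"
proof -
  obtain b where b: "stage_time n k = stage_time n (k - 1) + b"
    "real b / (4 * real (n choose k)) \<ge> real n / (41 * real (Suc k))"
    using stage_time_increment[OF n k] .
  have "dla_prob n (stage_time n k) (\<lambda>C. \<exists>S\<in>F. S \<inter> C = {})
      \<le> dla_prob n (stage_time n k) (\<lambda>C. ((\<exists>S\<in>F. S \<inter> C = {}) \<and> unblocked n k C) \<or> \<not> unblocked n k C)"
    by (rule dla_prob_mono) blast
  also have "\<dots> \<le> dla_prob n (stage_time n k) (\<lambda>C. (\<exists>S\<in>F. S \<inter> C = {}) \<and> unblocked n k C)
      + dla_prob n (stage_time n k) (\<lambda>C. \<not> unblocked n k C)"
    by (rule dla_prob_disj)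
  also have "\<dots> \<le> (dla_prob n (stage_time n (k - 1)) (\<lambda>C. \<not> supported n k C)
      + (\<Sum>S\<in>F. exp (- real (card S) * real b / (4 * real (n choose k))))) + 2 * exp (- real n / 10)"
    unfolding b(1)[symmetric]
    by (intro add_mono dla_prob_blocked[OF n], subst b(1), rule dla_prob_unfilled) (use F k n in auto)
  also have "(\<Sum>S\<in>F. exp (- real (card S) * real b / (4 * real (n choose k))))
      \<le> (\<Sum>S\<in>F. exp (- real (card S) * (real n / (41 * real (Suc k)))))"
  proof (rule sum_mono)
    fix S assume "S \<in> F"
    have "real (card S) * (real n / (41 * real (Suc k))) \<le> real (card S) * (real b / (4 * real (n choose k)))"
      using b(2) by (intro mult_left_mono) auto
    then show "exp (- real (card S) * real b / (4 * real (n choose k))) \<le> exp (- real (card S) * (real n / (41 * real (Suc k))))"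
      by simp
  qed
  finally show ?thesis by simp
qed

text \<open>An unsupported \<open>x\<close> on level \<open>k + 1\<close> has at least (k + 1) / 2
  empty lower neighbours. There are at most (n choose (k + 1)) 2^(k + 1) candidate sets of this
  kind, and each survives with probability at most exp (- n / 82), the factor k + 1 cancelling in
  the rate.\<close>

lemma dla_prob_unsupported_step:
  assumes n: "10000 * Suc k \<le> n" and k: "k \<ge> 1"
  shows "dla_prob n (stage_time n k) (\<lambda>C. \<not> supported n (Suc k) C)
    \<le> dla_prob n (stage_time n (k - 1)) (\<lambda>C. \<not> supported n k C) + 3 * exp (- real n / 200)"
proof -
  let ?ch = "\<lambda>x. (\<lambda>i. x - {i}) ` x"
  let ?Fx = "\<lambda>x. {S \<in> Pow (?ch x). Suc k \<le> 2 * card S}"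
  let ?F = "\<Union>x\<in>level n (Suc k). ?Fx x"
  have fx: "finite x" if "x \<in> level n (Suc k)" for x
    using that finite_subset[of x "{0..<n}"] by (auto simp: level_def cube_def)
  have inj: "inj_on (\<lambda>i. x - {i}) x" for x :: "nat set" by (auto simp: inj_on_def)
  have fF: "finite ?F" using fx by (auto simp: finite_level)
  have chl: "?ch x \<subseteq> level n k" if x: "x \<in> level n (Suc k)" for x
    using x fx[OF x] by (auto simp: level_def cube_def)
  have cF: "real (card ?F) \<le> real (n choose Suc k) * 2 ^ Suc k"
  proof -
    have "card ?F \<le> (\<Sum>x\<in>level n (Suc k). card (?Fx x))" by (intro card_UN_le finite_level)
    also have "\<dots> \<le> (\<Sum>x\<in>level n (Suc k). 2 ^ Suc k)"
    proof (rule sum_mono)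
      fix x assume x: "x \<in> level n (Suc k)"
      have "card (?Fx x) \<le> card (Pow (?ch x))" using fx[OF x] by (intro card_mono) auto
      also have "\<dots> = 2 ^ card x" using fx[OF x] inj by (simp add: card_Pow card_image)
      finally show "card (?Fx x) \<le> 2 ^ Suc k" using x by (simp add: level_def)
    qed
    finally have "card ?F \<le> (n choose Suc k) * 2 ^ Suc k" by (simp add: card_level)
    then have "real (card ?F) \<le> real ((n choose Suc k) * 2 ^ Suc k)" by (rule of_nat_mono)
    then show ?thesis by simp
  qed
  have "dla_prob n (stage_time n k) (\<lambda>C. \<not> supported n (Suc k) C)
      \<le> dla_prob n (stage_time n k) (\<lambda>C. \<exists>S\<in>?F. S \<inter> C = {})"
  proof (rule dla_prob_mono)
    fix C assume "\<not> supported n (Suc k) C"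
    then obtain x where x: "x \<in> level n (Suc k)" and less: "2 * card {i \<in> x. x - {i} \<in> C} < Suc k"
      by (auto simp: supported_def)
    define S where "S = (\<lambda>i. x - {i}) ` {i \<in> x. x - {i} \<notin> C}"
    have "card S = card {i \<in> x. x - {i} \<notin> C}"
      unfolding S_def by (rule card_image) (rule inj_on_subset[OF inj], auto)
    moreover have "card x = card {i \<in> x. x - {i} \<in> C} + card {i \<in> x. x - {i} \<notin> C}"
    proof -
      have "x = {i \<in> x. x - {i} \<in> C} \<union> {i \<in> x. x - {i} \<notin> C}" by auto
      moreover have "card ({i \<in> x. x - {i} \<in> C} \<union> {i \<in> x. x - {i} \<notin> C}) = card {i \<in> x. x - {i} \<in> C} + card {i \<in> x. x - {i} \<notin> C}"
        by (rule card_Un_disjoint) (use fx[OF x] in auto)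
      ultimately show ?thesis by simp
    qed
    moreover have "card x = Suc k" using x by (simp add: level_def)
    ultimately have "Suc k \<le> 2 * card S" using less by linarith
    then have "S \<in> ?F" using x by (auto simp: S_def)
    moreover have "S \<inter> C = {}" by (auto simp: S_def)
    ultimately show "\<exists>S\<in>?F. S \<inter> C = {}" by blast
  qed
  also have "\<dots> \<le> dla_prob n (stage_time n (k - 1)) (\<lambda>C. \<not> supported n k C) + 2 * exp (- real n / 10)
      + (\<Sum>S\<in>?F. exp (- real (card S) * (real n / (41 * real (Suc k)))))"
    using chl by (intro dla_prob_unfilled_stage[OF n k fF]) fast
  also have "(\<Sum>S\<in>?F. exp (- real (card S) * (real n / (41 * real (Suc k))))) \<le> (\<Sum>S\<in>?F. exp (- real n / 82))"
  proof (rule sum_mono)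
    fix S assume "S \<in> ?F"
    then have "Suc k \<le> 2 * card S" by auto
    then have "real (Suc k) / 2 * (real n / (41 * real (Suc k))) \<le> real (card S) * (real n / (41 * real (Suc k)))"
      by (intro mult_right_mono) auto
    moreover have "real (Suc k) / 2 * (real n / (41 * real (Suc k))) = real n / 82"
      by (simp add: field_simps del: of_nat_Suc)
    ultimately show "exp (- real (card S) * (real n / (41 * real (Suc k)))) \<le> exp (- real n / 82)"
      by (simp del: of_nat_Suc)
  qed
  also have "\<dots> \<le> (exp (real n / 500) * exp (real n / 1000)) * exp (- real n / 82)"
  proof -
    have "(2::real) ^ Suc k \<le> exp 1 ^ Suc k" using exp_ge_add_one_self[of 1] by (intro power_mono) auto
    also have "\<dots> = exp (real (Suc k))" by (simp add: exp_of_nat_mult[symmetric] del: of_nat_Suc power_Suc)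
    also have "\<dots> \<le> exp (real n / 1000)" using n by simp
    finally have "real (n choose Suc k) * 2 ^ Suc k \<le> exp (real n / 500) * exp (real n / 1000)"
      using binomial_le_exp[OF n] by (intro mult_mono) auto
    then show ?thesis using cF by (simp add: mult_right_mono)
  qed
  \<comment> \<open>Here 1/500 + 1/1000 - 1/82 < - 1/200.\<close>
  also have "\<dots> \<le> exp (- real n / 200)" by (simp flip: exp_add)
  also have "exp (- real n / 10) \<le> exp (- real n / 200)" by simp
  finally show ?thesis by simp
qed

text \<open>The induction starts at singletons, whose only lower neighbour \<open>{}\<close> is
  always occupied; each stage adds one error term.\<close>

lemma dla_prob_unsupported:
  assumes "10000 * Suc k \<le> n"
  shows "dla_prob n (stage_time n k) (\<lambda>C. \<not> supported n (Suc k) C) \<le> 3 * real k * exp (- real n / 200)"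
  using assms
proof (induction k)
  case 0
  have "supported n (Suc 0) C" if "cluster_valid n C" for C
  proof -
    have "Suc 0 \<le> 2 * card {i \<in> x. x - {i} \<in> C}" if x: "x \<in> level n (Suc 0)" for x
    proof -
      obtain i where i: "x = {i}" using x by (auto simp: level_def card_1_singleton_iff)
      have "{j \<in> x. x - {j} \<in> C} = {i}" using i \<open>cluster_valid n C\<close> by (auto simp: cluster_valid_def)
      then show ?thesis by simp
    qed
    then show ?thesis by (simp add: supported_def)
  qed
  then have "dla_prob n (stage_time n 0) (\<lambda>C. \<not> supported n (Suc 0) C) \<le> dla_prob n (stage_time n 0) (\<lambda>_. False)"
    by (intro dla_prob_mono) simp
  then show ?case by (simp add: dla_prob_False)
next
  case (Suc k)
  then show ?case using dla_prob_unsupported_step[of "Suc k" n] by (simp add: algebra_simps)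
qed

text \<open>A deficient level contains an empty set of exactly \<open>s\<close> vertices, where
  \<open>s\<close> is (n choose k) / n powr K rounded up. There are at most exp (s (1 + K ln n))
  such sets. By \<open>rate\<close>, the survival bound beats this count by a margin s n / (100 (k +
  1)); by \<open>large\<close>, either n / (k + 1) or \<open>s\<close> is at least sqrt n, so the
  margin is at least sqrt n / 100.\<close>

lemma dla_prob_deficient:
  fixes K :: real
  assumes n: "10000 * Suc k \<le> n" and k: "k \<ge> 1" and K: "K > 0"
    and rate: "1 + K * ln (real n) + real n / (100 * real (Suc k)) \<le> real n / (41 * real (Suc k))"
    and large: "real (Suc k) \<le> sqrt (real n) \<or> sqrt (real n) \<le> real (n choose k) / real n powr K"
  shows "dla_prob n (stage_time n k)
      (\<lambda>C. real (card (level n k \<inter> C)) < (1 - 1 / real n powr K) * real (n choose k))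
    \<le> 3 * real n * exp (- real n / 200) + 2 * exp (- real n / 10) + exp (- sqrt (real n) / 100)"
proof -
  let ?N = "n choose k"
  let ?y = "real n / real (Suc k)"
  have n0: "n > 0" using n by simp
  define x where "x = 1 / real n powr K"
  have x: "x > 0" using n0 by (simp add: x_def)
  define s where "s = nat \<lceil>x * real ?N\<rceil>"
  have sx: "x * real ?N \<le> real s" by (simp add: s_def real_nat_ceiling_ge)
  have "0 < x * real ?N" using x n by simp
  then have s1: "s \<ge> 1" unfolding s_def by linarith
  let ?F = "{S. S \<subseteq> level n k \<and> card S = s}"
  have "dla_prob n (stage_time n k) (\<lambda>C. real (card (level n k \<inter> C)) < (1 - 1 / real n powr K) * real ?N)
      \<le> dla_prob n (stage_time n k) (\<lambda>C. \<exists>S\<in>?F. S \<inter> C = {})"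
  proof (rule dla_prob_mono)
    fix C assume "real (card (level n k \<inter> C)) < (1 - 1 / real n powr K) * real ?N"
    then have lt: "real (card (level n k \<inter> C)) < real ?N - x * real ?N" by (simp add: x_def algebra_simps)
    have "card (level n k - C) = ?N - card (level n k \<inter> C)"
      by (simp add: card_Diff_subset_Int finite_level card_level)
    moreover have "card (level n k \<inter> C) \<le> ?N" using card_mono[OF finite_level, of "level n k \<inter> C"] by (simp add: card_level)
    ultimately have "x * real ?N \<le> real (card (level n k - C))" using lt by (simp add: of_nat_diff)
    then have "s \<le> card (level n k - C)" unfolding s_def by linarith
    then obtain S where "S \<subseteq> level n k - C" "card S = s" by (rule obtain_subset_with_card_n)
    then show "\<exists>S\<in>?F. S \<inter> C = {}" by blast
  qed
  also have "\<dots> \<le> dla_prob n (stage_time n (k - 1)) (\<lambda>C. \<not> supported n k C) + 2 * exp (- real n / 10)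
      + (\<Sum>S\<in>?F. exp (- real (card S) * (real n / (41 * real (Suc k)))))"
    by (rule dla_prob_unfilled_stage[OF n k]) (auto simp: finite_level)
  also have "dla_prob n (stage_time n (k - 1)) (\<lambda>C. \<not> supported n k C) \<le> 3 * real n * exp (- real n / 200)"
  proof -
    have "dla_prob n (stage_time n (k - 1)) (\<lambda>C. \<not> supported n k C) \<le> 3 * real (k - 1) * exp (- real n / 200)"
      using dla_prob_unsupported[of "k - 1" n] k n by simp
    also have "\<dots> \<le> 3 * real n * exp (- real n / 200)" using n by (intro mult_right_mono) auto
    finally show ?thesis .
  qed
  also have "(\<Sum>S\<in>?F. exp (- real (card S) * (real n / (41 * real (Suc k))))) = real (?N choose s) * exp (- real s * (real n / (41 * real (Suc k))))"
    using n_subsets[OF finite_level, of n k s] by (simp add: card_level)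
  also have "\<dots> \<le> exp (real s * (1 + K * ln (real n))) * exp (- real s * (real n / (41 * real (Suc k))))"
  proof (rule mult_right_mono)
    have "real (?N choose s) \<le> exp (x * real ?N) / x ^ s" by (rule binomial_le_exp_div_power[OF x])
    also have "\<dots> \<le> exp (real s) / x ^ s" using sx x by (intro divide_right_mono) auto
    \<comment> \<open>As an exponential, \<open>x\<close> lets the count of sets and the survival
      bound combine into one exponent.\<close>
    also have "x = exp (- (K * ln (real n)))" using n0 by (simp add: x_def powr_def exp_minus inverse_eq_divide)
    also have "exp (real s) / \<dots> ^ s = exp (real s * (1 + K * ln (real n)))"
      by (simp add: exp_of_nat_mult[symmetric] exp_diff[symmetric] algebra_simps)
    finally show "real (?N choose s) \<le> \<dots>" .
  qed simp
  also have "\<dots> = exp (real s * (1 + K * ln (real n) - real n / (41 * real (Suc k))))"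
    by (simp add: exp_add[symmetric] algebra_simps)
  also have "\<dots> \<le> exp (- sqrt (real n) / 100)"
  proof -
    have "real s * (1 + K * ln (real n) - real n / (41 * real (Suc k))) \<le> real s * (- (real n / (100 * real (Suc k))))"
      using rate by (intro mult_left_mono) auto
    also have "\<dots> = - (real s * ?y) / 100" by simp
    also have "\<dots> \<le> - sqrt (real n) / 100"
    proof -
      have "sqrt (real n) \<le> real s * ?y"
      proof (cases "real (Suc k) \<le> sqrt (real n)")
        case True
        have "sqrt (real n) = real n / sqrt (real n)" by (simp add: real_div_sqrt)
        also have "\<dots> \<le> ?y" using True n0 by (intro divide_left_mono mult_pos_pos) auto
        also have "\<dots> \<le> real s * ?y" using s1 mult_right_mono[of 1 "real s" ?y] by simp
        finally show ?thesis .
      next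
        case False
        then have "sqrt (real n) \<le> real s" using large sx by (simp add: x_def)
        also have "\<dots> \<le> real s * ?y" using n mult_left_mono[of 1 ?y "real s"] by (simp add: field_simps)
        finally show ?thesis .
      qed
      then show ?thesis by (intro divide_right_mono) auto
    qed
    finally show ?thesis by simp
  qed
  finally show ?thesis by simp
qed

section \<open>Union bound over the levels\<close>

theorem theorem2:
  fixes K :: real
  assumes "K > 0"
  shows "(\<lambda>n. measure_pmf.prob (dla_final n)
            {C. \<forall>k::nat. real k \<le> real n / (150 * K * ln (real n)) \<longrightarrow>
                 real (card (level n k \<inter> C)) \<ge> (1 - 1 / real n powr K) * real (n choose k)})
         \<longlonglongrightarrow> 1"
proof -
  define err where "err = (\<lambda>n. real n * (3 * real n * exp (- real n / 200) + 2 * exp (- real n / 10) + exp (- sqrt (real n) / 100)))"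
  let ?good = "\<lambda>n C. \<forall>k::nat. real k \<le> real n / (150 * K * ln (real n)) \<longrightarrow>
                 real (card (level n k \<inter> C)) \<ge> (1 - 1 / real n powr K) * real (n choose k)"
  let ?bad = "\<lambda>n k C. real (card (level n k \<inter> C)) < (1 - 1 / real n powr K) * real (n choose k)"
  \<comment> \<open>The height bound is o(n) for every \<open>K\<close>, so eventually
    \<open>10000 * Suc k <= n\<close> on the whole range.\<close>
  have e1: "eventually (\<lambda>n::nat. real n / (150 * K * ln (real n)) + 1 \<le> real n / 10000) at_top"
    using assms by real_asymp
  \<comment> \<open>Needed when k + 1 > sqrt n: then (n choose k) >= 2^k outweighs sqrt n times n
    powr K.\<close>
  have e2: "eventually (\<lambda>n::nat. sqrt (real n) * real n powr K \<le> 2 powr (sqrt (real n) - 1)) at_top"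
    using assms by real_asymp
  have e3: "eventually (\<lambda>n::nat. n \<ge> 3) at_top" by (rule eventually_ge_at_top)
  have lower: "eventually (\<lambda>n. 1 - err n \<le> measure_pmf.prob (dla_final n) {C. ?good n C}) at_top"
    using e1 e2 e3
  proof eventually_elim
    case (elim n)
    have ln0: "ln (real n) > 0" using elim(3) by simp
    \<comment> \<open>Level 0 is left out: it is full from the start and is treated
      separately.\<close>
    define I where "I = {k. 1 \<le> k \<and> real k \<le> real n / (150 * K * ln (real n))}"
    have big: "10000 * Suc k \<le> n" if "k \<in> I" for k
    proof -
      have "10000 * real (Suc k) \<le> real n" using that elim(1) by (simp add: I_def)
      then show ?thesis by linarith
    qed
    have IS: "I \<subseteq> {1..n}" using big by (force simp: I_def)
    then have fI: "finite I" by (rule finite_subset) simp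
    have cI: "card I \<le> n" using card_mono[OF _ IS] by simp
    have level_bound: "dla_prob n (2 ^ n) (?bad n k)
      \<le> 3 * real n * exp (- real n / 200) + 2 * exp (- real n / 10) + exp (- sqrt (real n) / 100)" if kI: "k \<in> I" for k
    proof -
      have k: "k \<ge> 1" "real k \<le> real n / (150 * K * ln (real n))" using kI by (auto simp: I_def)
      note kn = big[OF kI]
      have mono: "dla_prob n (2 ^ n) (?bad n k) \<le> dla_prob n (stage_time n k) (?bad n k)"
      proof (rule dla_prob_antimono_time[OF stage_time_le_pow2])
        fix C C' assume "C \<subseteq> C'" "?bad n k C'"
        moreover have "card (level n k \<inter> C) \<le> card (level n k \<inter> C')"
          using \<open>C \<subseteq> C'\<close> by (intro card_mono) (auto simp: finite_level)
        ultimately show "?bad n k C" by linarith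
      qed
      define y where "y = real n / real (Suc k)"
      have y: "y \<ge> 10000"
      proof -
        have "10000 * real (Suc k) \<le> real n" using kn by linarith
        then show ?thesis by (simp add: y_def field_simps)
      qed
      \<comment> \<open>For k >= 1, k + 1 <= 2 k turns the constant 150 into 75.\<close>
      have Ky: "K * ln (real n) \<le> y / 75"
      proof -
        define c where "c = K * ln (real n)"
        have c: "c > 0" using ln0 assms by (simp add: c_def)
        have "real (Suc k) * (75 * c) \<le> (2 * real k) * (75 * c)"
          using k(1) c by (intro mult_right_mono) auto
        also have "\<dots> = real k * (150 * c)" by simp
        also have "\<dots> \<le> real n" using k(2) c by (simp add: c_def pos_le_divide_eq mult.assoc)
        finally have "c \<le> real n / real (Suc k) / 75" by (simp add: field_simps)
        then show ?thesis by (simp add: y_def c_def)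
      qed
      have rate: "1 + K * ln (real n) + real n / (100 * real (Suc k)) \<le> real n / (41 * real (Suc k))"
      proof -
        \<comment> \<open>As y >= 10000, this amounts to 1/10000 + 1/75 + 1/100 < 1/41.\<close>
        have "1 + K * ln (real n) + y / 100 \<le> y / 41" using Ky y by linarith
        moreover have "real n / (100 * real (Suc k)) = y / 100" "real n / (41 * real (Suc k)) = y / 41"
          by (simp_all add: y_def)
        ultimately show ?thesis by metis
      qed
      have large: "real (Suc k) \<le> sqrt (real n) \<or> sqrt (real n) \<le> real (n choose k) / real n powr K"
      proof (cases "real (Suc k) \<le> sqrt (real n)")
        case False
        have "sqrt (real n) * real n powr K \<le> 2 powr (sqrt (real n) - 1)" by (rule elim(2))
        also have "\<dots> \<le> 2 powr (real k)" using False by (intro powr_mono) auto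
        also have "\<dots> = 2 ^ k" by (simp add: powr_realpow)
        also have "\<dots> \<le> (real n / real k) ^ k"
        proof (rule power_mono)
          show "2 \<le> real n / real k" using kn k(1) by (simp add: field_simps)
        qed simp
        also have "\<dots> \<le> real (n choose k)" using kn by (intro binomial_ge_n_over_k_pow_k) auto
        finally show ?thesis using elim(3) by (simp add: pos_le_divide_eq)
      qed simp
      show ?thesis using mono dla_prob_deficient[OF kn k(1) assms rate large] by linarith
    qed
    have "dla_prob n (2 ^ n) (\<lambda>C. \<not> ?good n C) \<le> dla_prob n (2 ^ n) (\<lambda>C. \<exists>k\<in>I. ?bad n k C)"
    proof (rule dla_prob_mono)
      fix C assume C: "cluster_valid n C" and "\<not> ?good n C"
      then obtain k where k: "real k \<le> real n / (150 * K * ln (real n))" "?bad n k C" by (auto simp: not_le)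
      have "k \<noteq> 0"
      proof
        assume "k = 0"
        moreover have "level n 0 \<inter> C = {{}}" using C by (auto simp: level_empty cluster_valid_def)
        ultimately show False using k(2) by simp
      qed
      then have "k \<in> I" using k(1) by (simp add: I_def)
      then show "\<exists>k\<in>I. ?bad n k C" using k(2) by blast
    qed
    also have "\<dots> \<le> (\<Sum>k\<in>I. dla_prob n (2 ^ n) (?bad n k))" by (rule dla_prob_bex[OF fI])
    also have "\<dots> \<le> (\<Sum>k\<in>I. 3 * real n * exp (- real n / 200) + 2 * exp (- real n / 10) + exp (- sqrt (real n) / 100))"
      by (rule sum_mono) (rule level_bound)
    also have "\<dots> = real (card I) * (3 * real n * exp (- real n / 200) + 2 * exp (- real n / 10) + exp (- sqrt (real n) / 100))"
      by simp
    also have "\<dots> \<le> err n" unfolding err_def using cI by (intro mult_right_mono) (auto intro!: add_nonneg_nonneg)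
    finally have "dla_prob n (2 ^ n) (\<lambda>C. \<not> ?good n C) \<le> err n" .
    moreover have "measure_pmf.prob (dla_final n) {C. \<not> ?good n C} = 1 - measure_pmf.prob (dla_final n) {C. ?good n C}"
      by (rule prob_Collect_not)
    moreover have "measure_pmf.prob (dla_final n) {C. \<not> ?good n C} = dla_prob n (2 ^ n) (\<lambda>C. \<not> ?good n C)"
      unfolding dla_final_def by (rule prob_dla_cluster)
    ultimately show ?case by linarith
  qed
  have lim: "(\<lambda>n. 1 - err n) \<longlonglongrightarrow> 1"
    unfolding err_def by real_asymp
  show ?thesis
    by (rule tendsto_sandwich[OF lower _ lim tendsto_const]) simp
qed

end
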